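(* Let $A=(a_{i,j})$ be a real $\ell\times\ell$ matrix satisfying (P1)–(P3), and assume $A$ is symmetrizable, indecomposable, and $\ell\ge 2$. Let $\mathfrak g=\mathfrak g(A)$ be the associated generalized Kac–Moody algebra with Cartan subalgebra $\mathfrak h$. Let $$\mathfrak g^o_{\mathrm{nil}}:=\{x\in\mathfrak g:\ \operatorname{ad}x \text{ acts locally nilpotently on }\mathfrak g\},$$ and let $\mathfrak g_{\mathrm{nil}}\subset\mathfrak g$ be the Lie subalgebra generated by $\mathfrak g^o_{\mathrm{nil}}$. Then $$\mathfrak g'(B)\subset \mathfrak g_{\mathrm{nil}}\subset \mathfrak g'(B)+\mathfrak h .$$
   Context: Let $A=(a_{i,j})_{1\le i,j\le \ell}$ be a real matrix with: (P1) either $a_{i,i}=2$ or $a_{i,i}\le 0$; (P2) $a_{i,j}\le 0$ for $i\ne j$, and $a_{i,j}\in\mathbb Z$ whenever $a_{i,i}=2$; (P3) $a_{i,j}=0$ iff $a_{j,i}=0$. A realization of $A$ is a triple $(\mathfrak h,\Pi,\Pi^\vee)$ with $\mathfrak h$ a complex vector space, $\Pi=\{\alpha_1,\dots,\alpha_\ell\}\subset\mathfrak h^*$ and $\Pi^\vee=\{\alpha_1^\vee,\dots,\alpha_\ell^\vee\}\subset\mathfrak h$ linearly independent, $\alpha_j(\alpha_i^\vee)=a_{i,j}$, and $\dim\mathfrak h=2\ell-\operatorname{rank}A$ (unique up to isomorphism). The generalized Kac–Moody (Borcherds) algebra $\mathfrak g(A)$ is the Lie algebra generated by $e_i,f_i$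 ($1\le i\le\ell$) and $\mathfrak h$ with relations: $[e_i,f_j]=\delta_{ij}\alpha_i^\vee$; $[h,h']=0$ for $h,h'\in\mathfrak h$; $[h,e_i]=\alpha_i(h)e_i$, $[h,f_i]=-\alpha_i(h)f_i$; $(\operatorname{ad}e_i)^{1-a_{i,j}}e_j=(\operatorname{ad}f_i)^{1-a_{i,j}}f_j=0$ if $a_{i,i}=2$ and $i\ne j$; $[e_i,e_j]=[f_i,f_j]=0$ if $a_{i,j}=0$. $A$ is symmetrizable if there is an invertible diagonal matrix $D$ with $DA$ symmetric; $A$ is indecomposable if its Dynkin diagram (vertices $1,\dots,\ell$, $i\ne j$ joined iff $a_{i,j}\neq0$) is connected. A simple root $\alpha_i$ is called real if $a_{i,i}=2$ and imaginary if $a_{i,i}\le 0$. $B$ denotes the submatrix of $A$ with rows and columns indexed by $\{i: a_{i,i}=2\}$, and $\mathfrak g'(B)$ denotes the derived subalgebra of $\mathfrak g(B)$, identified with the Lie subalgebra of $\mathfrak g$ generated by $\{e_i,f_i: a_{i,i}=2\}$ (it is $0$ if there are no such $i$). *)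

theory Defs
  imports Complex_Main
begin

section \<open>Cartan matrices (indices 0..<l), conditions (P1)-(P3)\<close>

type_synonym rmat = "nat \<Rightarrow> nat \<Rightarrow> real"

definition gkm_matrix :: "nat \<Rightarrow> rmat \<Rightarrow> bool" where
  "gkm_matrix l a \<longleftrightarrow>
     (\<forall>i<l. a i i = 2 \<or> a i i \<le> 0) \<and>
     (\<forall>i<l. \<forall>j<l. i \<noteq> j \<longrightarrow> a i j \<le> 0) \<and>
     (\<forall>i<l. \<forall>j<l. a i i = 2 \<longrightarrow> a i j \<in> \<int>) \<and>
     (\<forall>i<l. \<forall>j<l. a i j = 0 \<longleftrightarrow> a j i = 0)"

text \<open>Symmetrizable: an invertible diagonal D = diag(d_0,...,d_{l-1}) with DA symmetric.\<close>
definition symmetrizable :: "nat \<Rightarrow> rmat \<Rightarrow> bool" where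
  "symmetrizable l a \<longleftrightarrow>
     (\<exists>d::nat \<Rightarrow> real. (\<forall>i<l. d i \<noteq> 0) \<and> (\<forall>i<l. \<forall>j<l. d i * a i j = d j * a j i))"

text \<open>Indecomposable: the Dynkin diagram on vertices 0..<l is connected.\<close>
definition dynkin_edges :: "nat \<Rightarrow> rmat \<Rightarrow> (nat \<times> nat) set" where
  "dynkin_edges l a = {(i, j). i < l \<and> j < l \<and> i \<noteq> j \<and> a i j \<noteq> 0}"

definition indecomposable :: "nat \<Rightarrow> rmat \<Rightarrow> bool" where
  "indecomposable l a \<longleftrightarrow> (\<forall>i<l. \<forall>j<l. (i, j) \<in> (dynkin_edges l a)\<^sup>*)"

text \<open>Rank of the real l x l matrix = maximal number of linearly independent rows.\<close>
definition rows_lin_indep :: "nat \<Rightarrow> rmat \<Rightarrow> nat set \<Rightarrow> bool" where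
  "rows_lin_indep l a S \<longleftrightarrow>
     (\<forall>c::nat \<Rightarrow> real. (\<forall>j<l. (\<Sum>i\<in>S. c i * a i j) = 0) \<longrightarrow> (\<forall>i\<in>S. c i = 0))"

definition mat_rank :: "nat \<Rightarrow> rmat \<Rightarrow> nat" where
  "mat_rank l a = Max {card S | S. S \<subseteq> {..<l} \<and> rows_lin_indep l a S}"

section \<open>Realizations: h = C^d (coordinates 0..<d)\<close>

text \<open>@cor i@ is the coroot alpha_i^vee in C^d; @rt j@ is the coefficient vector of
  the functional alpha_j, i.e. alpha_j(h) = sum_k rt j k * h k.\<close>
definition realization ::
  "nat \<Rightarrow> rmat \<Rightarrow> nat \<Rightarrow> (nat \<Rightarrow> nat \<Rightarrow> complex) \<Rightarrow> (nat \<Rightarrow> nat \<Rightarrow> complex) \<Rightarrow> bool" where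
  "realization l a d rt cor \<longleftrightarrow>
     d = 2 * l - mat_rank l a \<and>
     (\<forall>c::nat \<Rightarrow> complex. (\<forall>k<d. (\<Sum>i<l. c i * cor i k) = 0) \<longrightarrow> (\<forall>i<l. c i = 0)) \<and>
     (\<forall>c::nat \<Rightarrow> complex. (\<forall>k<d. (\<Sum>i<l. c i * rt i k) = 0) \<longrightarrow> (\<forall>i<l. c i = 0)) \<and>
     (\<forall>i<l. \<forall>j<l. (\<Sum>k<d. rt j k * cor i k) = complex_of_real (a i j))"

section \<open>Free associative algebra on the generators, commutator, generated Lie algebra\<close>

datatype gen = E nat | F nat | H nat

type_synonym elt = "gen list \<Rightarrow> complex"

definition padd :: "elt \<Rightarrow> elt \<Rightarrow> elt" where "padd p q = (\<lambda>w. p w + q w)"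
definition psub :: "elt \<Rightarrow> elt \<Rightarrow> elt" where "psub p q = (\<lambda>w. p w - q w)"
definition psmult :: "complex \<Rightarrow> elt \<Rightarrow> elt" where "psmult c p = (\<lambda>w. c * p w)"
definition pzero :: elt where "pzero = (\<lambda>w. 0)"
definition pmul :: "elt \<Rightarrow> elt \<Rightarrow> elt" where
  "pmul p q = (\<lambda>w. \<Sum>k\<le>length w. p (take k w) * q (drop k w))"
definition br :: "elt \<Rightarrow> elt \<Rightarrow> elt" where "br p q = psub (pmul p q) (pmul q p)"
definition gel :: "gen \<Rightarrow> elt" where "gel x = (\<lambda>w. if w = [x] then 1 else 0)"

text \<open>Lie subalgebra generated by S (the free Lie algebra when S is the set of generators).\<close>
inductive_set lie_gen :: "elt set \<Rightarrow> elt set" for S where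
  base: "x \<in> S \<Longrightarrow> x \<in> lie_gen S"
| zero: "pzero \<in> lie_gen S"
| add: "x \<in> lie_gen S \<Longrightarrow> y \<in> lie_gen S \<Longrightarrow> padd x y \<in> lie_gen S"
| smult: "x \<in> lie_gen S \<Longrightarrow> psmult c x \<in> lie_gen S"
| brk: "x \<in> lie_gen S \<Longrightarrow> y \<in> lie_gen S \<Longrightarrow> br x y \<in> lie_gen S"

text \<open>Ideal of the Lie algebra L generated by R.\<close>
inductive_set lie_ideal :: "elt set \<Rightarrow> elt set \<Rightarrow> elt set" for L R where
  base: "x \<in> R \<Longrightarrow> x \<in> lie_ideal L R"
| zero: "pzero \<in> lie_ideal L R"
| add: "x \<in> lie_ideal L R \<Longrightarrow> y \<in> lie_ideal L R \<Longrightarrow> padd x y \<in> lie_ideal L R"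
| smult: "x \<in> lie_ideal L R \<Longrightarrow> psmult c x \<in> lie_ideal L R"
| brk: "y \<in> L \<Longrightarrow> x \<in> lie_ideal L R \<Longrightarrow> br y x \<in> lie_ideal L R"

section \<open>The generalized Kac--Moody algebra g(A) = L / I\<close>

definition hsum :: "nat \<Rightarrow> (nat \<Rightarrow> complex) \<Rightarrow> elt" where
  "hsum d c = (\<lambda>w. \<Sum>k<d. c k * gel (H k) w)"

text \<open>Free Lie algebra on e_i, f_i (i<l) and a basis H_0..H_{d-1} of h.\<close>
definition free_L :: "nat \<Rightarrow> nat \<Rightarrow> elt set" where
  "free_L l d = lie_gen ({gel (E i) | i. i < l} \<union> {gel (F i) | i. i < l} \<union> {gel (H k) | k. k < d})"

definition ad_pow :: "elt \<Rightarrow> nat \<Rightarrow> elt \<Rightarrow> elt" where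
  "ad_pow x n y = ((br x) ^^ n) y"

definition gkm_relations ::
  "nat \<Rightarrow> rmat \<Rightarrow> nat \<Rightarrow> (nat \<Rightarrow> nat \<Rightarrow> complex) \<Rightarrow> (nat \<Rightarrow> nat \<Rightarrow> complex) \<Rightarrow> elt set" where
  "gkm_relations l a d rt cor =
     {psub (br (gel (E i)) (gel (F j))) (if i = j then hsum d (cor i) else pzero) | i j. i < l \<and> j < l}
   \<union> {br (gel (H k)) (gel (H k')) | k k'. k < d \<and> k' < d}
   \<union> {psub (br (gel (H k)) (gel (E i))) (psmult (rt i k) (gel (E i))) | k i. k < d \<and> i < l}
   \<union> {padd (br (gel (H k)) (gel (F i))) (psmult (rt i k) (gel (F i))) | k i. k < d \<and> i < l}
   \<union> {ad_pow (gel (E i)) (nat (1 - \<lfloor>a i j\<rfloor>)) (gel (E j)) | i j. i < l \<and> j < l \<and> i \<noteq> j \<and> a i i = 2}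
   \<union> {ad_pow (gel (F i)) (nat (1 - \<lfloor>a i j\<rfloor>)) (gel (F j)) | i j. i < l \<and> j < l \<and> i \<noteq> j \<and> a i i = 2}
   \<union> {br (gel (E i)) (gel (E j)) | i j. i < l \<and> j < l \<and> a i j = 0}
   \<union> {br (gel (F i)) (gel (F j)) | i j. i < l \<and> j < l \<and> a i j = 0}"

text \<open>The kernel I of L -> g(A); elements of g(A) are classes x + I, x in L.
  Subspaces/subalgebras of g(A) are represented by their preimages in L (which contain I).\<close>
definition gkm_ideal ::
  "nat \<Rightarrow> rmat \<Rightarrow> nat \<Rightarrow> (nat \<Rightarrow> nat \<Rightarrow> complex) \<Rightarrow> (nat \<Rightarrow> nat \<Rightarrow> complex) \<Rightarrow> elt set" where
  "gkm_ideal l a d rt cor = lie_ideal (free_L l d) (gkm_relations l a d rt cor)"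

text \<open>Preimage of g^o_nil: x such that ad x is locally nilpotent on g(A).\<close>
definition g_nil_o ::
  "nat \<Rightarrow> rmat \<Rightarrow> nat \<Rightarrow> (nat \<Rightarrow> nat \<Rightarrow> complex) \<Rightarrow> (nat \<Rightarrow> nat \<Rightarrow> complex) \<Rightarrow> elt set" where
  "g_nil_o l a d rt cor =
     {x \<in> free_L l d. \<forall>y \<in> free_L l d. \<exists>n. ad_pow x n y \<in> gkm_ideal l a d rt cor}"

text \<open>Preimage of g_nil, the Lie subalgebra generated by g^o_nil.\<close>
definition g_nil ::
  "nat \<Rightarrow> rmat \<Rightarrow> nat \<Rightarrow> (nat \<Rightarrow> nat \<Rightarrow> complex) \<Rightarrow> (nat \<Rightarrow> nat \<Rightarrow> complex) \<Rightarrow> elt set" where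
  "g_nil l a d rt cor = lie_gen (g_nil_o l a d rt cor \<union> gkm_ideal l a d rt cor)"

text \<open>Preimage of g'(B): subalgebra generated by e_i, f_i with a_ii = 2.\<close>
definition g_B ::
  "nat \<Rightarrow> rmat \<Rightarrow> nat \<Rightarrow> (nat \<Rightarrow> nat \<Rightarrow> complex) \<Rightarrow> (nat \<Rightarrow> nat \<Rightarrow> complex) \<Rightarrow> elt set" where
  "g_B l a d rt cor = lie_gen ({gel (E i) | i. i < l \<and> a i i = 2} \<union> {gel (F i) | i. i < l \<and> a i i = 2}
                              \<union> gkm_ideal l a d rt cor)"

text \<open>Preimage of h.\<close>
definition h_part ::
  "nat \<Rightarrow> rmat \<Rightarrow> nat \<Rightarrow> (nat \<Rightarrow> nat \<Rightarrow> complex) \<Rightarrow> (nat \<Rightarrow> nat \<Rightarrow> complex) \<Rightarrow> elt set" where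
  "h_part l a d rt cor = {padd (hsum d c) z | c z. z \<in> gkm_ideal l a d rt cor}"

definition set_plus_elt :: "elt set \<Rightarrow> elt set \<Rightarrow> elt set" where
  "set_plus_elt U V = {padd u v | u v. u \<in> U \<and> v \<in> V}"

end

theory Submission
  imports Defs "HOL-Library.Function_Algebras"
begin

text \<open>Let \<open>i\<close> be an imaginary index and grade \<open>\<gg>\<close> by the coefficient of \<open>\<alpha>\<^sub>i\<close>. As no Serre relation has
  degree at least 2 in \<open>e\<^sub>i\<close> or \<open>f\<^sub>i\<close>, all relations live in degrees \<open>-1, 0, 1\<close>, and \<open>\<gg>\<close> acts on the tensor
  algebra of a space \<open>V\<close> containing the degree one part: degree 1 by left multiplication, degree 0 by
  derivations, degree \<open>-1\<close> by contractions. (We take \<open>V = \<gg>\<close> and work with the dual space, multilinear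
  functions on \<open>\<gg>\<close>, which avoids choosing bases.) Hence the positive part of \<open>\<gg>\<close> is free on its degree one
  part, which has dimension at least 2 by indecomposability, and in such a free Lie algebra no
  nonzero element is locally ad-nilpotent. If \<open>ad x\<close> is locally nilpotent on \<open>\<gg>\<close>, then so is its top
  component, as far as degree one elements are concerned, so \<open>x\<close> has no components of positive degree;
  symmetrically none of negative degree. This holds for all imaginary \<open>i\<close>, so by the triangular
  decomposition \<open>x\<close> lies in \<open>\<gg>'(B) + \<hh>\<close>, which is a subalgebra. The other inclusion is the local
  ad-nilpotency of the real simple root vectors.\<close>

section \<open>Lie algebras\<close>

text \<open>The tensor algebra is built over the very quotient that is to be analysed. This is not
  circular: the free algebra acts through any choice of operators for its letters, and only the
  relators have to be shown to act as zero. The three operator formulas make sense for every element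
  of \<gg>, whatever its degree, and the relations between them hold by definition or by the Jacobi
  identity. So a relator that is built inside degrees -1, 0, 1 acts by the operator attached to its
  own class, which is zero. A relator of degree 2 or more would act by commutators of left
  multiplications, which have no reason to vanish; this is why \<open>i\<close> has to be imaginary.

  A class \<open>x\<close> of degree M that is not zero is seen by the functional taking a word to
  \<open>f\<close> of its nested bracket: its value on \<open>x\<close> is M times
  \<open>f x\<close>. Splitting this functional along two independent elements of degree one yields
  a summand that is nonzero on \<open>x\<close> but kills all words beginning with one of the two
  elements; tensor powers of that summand detect the powers of \<open>ad x\<close>.\<close>

locale lie_algebra = vector_space scale
  for scale :: "complex \<Rightarrow> 'a::ab_group_add \<Rightarrow> 'a" +
  fixes bracket :: "'a \<Rightarrow> 'a \<Rightarrow> 'a"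
  assumes bracket_add_left: "bracket (x + y) z = bracket x z + bracket y z"
    and bracket_scale_left: "bracket (scale c x) z = scale c (bracket x z)"
    and bracket_self [simp]: "bracket x x = 0"
    and bracket_anti: "bracket x y = - bracket y x"
    and jacobi: "bracket x (bracket y z) = bracket (bracket x y) z + bracket y (bracket x z)"
begin

lemma bracket_add_right: "bracket x (y + z) = bracket x y + bracket x z"
  by (metis bracket_add_left bracket_anti minus_add_distrib)

lemma bracket_scale_right: "bracket x (scale c y) = scale c (bracket x y)"
  by (metis bracket_scale_left bracket_anti scale_minus_right)

lemma bracket_zero_left [simp]: "bracket 0 x = 0"
  using bracket_add_left[of 0 0 x] by simp

lemma bracket_zero_right [simp]: "bracket x 0 = 0"
  using bracket_add_right[of x 0 0] by simp

lemma bracket_minus_left: "bracket (- x) y = - bracket x y"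
  using bracket_add_left[of x "- x" y] by (simp add: eq_neg_iff_add_eq_0 add.commute)

lemma bracket_minus_right: "bracket x (- y) = - bracket x y"
  using bracket_add_right[of x y "- y"] by (simp add: eq_neg_iff_add_eq_0 add.commute)

lemma bracket_diff_left: "bracket (x - y) z = bracket x z - bracket y z"
  using bracket_add_left[of x "- y" z] by (simp add: bracket_minus_left)

lemma bracket_diff_right: "bracket x (y - z) = bracket x y - bracket x z"
  using bracket_add_right[of x y "- z"] by (simp add: bracket_minus_right)

lemmas bracket_linear = bracket_add_left bracket_add_right bracket_diff_left bracket_diff_right
  bracket_scale_left bracket_scale_right bracket_minus_left bracket_minus_right

lemma bracket_sum_right: "bracket x (sum f A) = (\<Sum>k\<in>A. bracket x (f k))"
  by (induction A rule: infinite_finite_induct) (auto simp: bracket_add_right)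

lemma bracket_sum_left: "bracket (sum f A) x = (\<Sum>k\<in>A. bracket (f k) x)"
  by (induction A rule: infinite_finite_induct) (auto simp: bracket_add_left)

lemma separating_functional:
  assumes "subspace S" "x \<notin> S"
  obtains f where "Vector_Spaces.linear scale (*) f" "\<And>y. y \<in> S \<Longrightarrow> f y = 0" "f x = (1::complex)"
proof -
  interpret functional: vector_space_pair scale "(*) :: complex \<Rightarrow> complex \<Rightarrow> complex"
    by unfold_locales (auto simp: algebra_simps)
  obtain B where B: "B \<subseteq> S" "independent B" "S \<subseteq> span B"
    using maximal_independent_subset by blast
  have "span B \<subseteq> S" using B assms span_minimal by blast
  with assms B have ind: "independent (insert x B)" and "x \<notin> B"
    using independent_insert[of x B] by auto
  then obtain f where f: "Vector_Spaces.linear scale (*) f"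
      "\<forall>y\<in>insert x B. f y = (if y = x then 1 else 0 :: complex)"
    using functional.linear_independent_extend[of "insert x B" "\<lambda>y. if y = x then 1 else 0"] by blast
  have "f y = 0" if "y \<in> S" for y
  proof -
    have "y \<in> span B" using that B by blast
    moreover have "f b = 0" if "b \<in> B" for b
      using f(2) \<open>x \<notin> B\<close> that by auto
    ultimately show ?thesis
      using functional.linear_eq_0_on_span[OF f(1), of B y] by blast
  qed
  with f that show thesis by auto
qed

end

section \<open>The free associative algebra\<close>

lemma padd_eq: "padd p q = p + q" by (simp add: padd_def plus_fun_def)
lemma psub_eq: "psub p q = p - q" by (simp add: psub_def fun_diff_def)
lemma pzero_eq: "pzero = 0" by (simp add: pzero_def zero_fun_def)
lemmas elt_eqs = padd_eq psub_eq pzero_eq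

lemma pmul_Nil [simp]: "pmul p q [] = p [] * q []"
  by (simp add: pmul_def)

text \<open>Peeling off the first letter turns the convolution into a recursion, so that
  associativity becomes an induction on the word.\<close>

lemma pmul_Cons [simp]: "pmul p q (g # w) = p [] * q (g # w) + pmul (\<lambda>v. p (g # v)) q w"
proof -
  have *: "{..Suc n} = insert 0 (Suc ` {..n})" for n
    by (auto simp: image_iff) (metis atMost_iff not0_implies_Suc Suc_le_mono)
  show ?thesis by (simp add: pmul_def * sum.reindex)
qed

lemma pmul_add_left: "pmul (p + p') q = pmul p q + pmul p' q"
  by (simp add: pmul_def fun_eq_iff algebra_simps sum.distrib)
lemma pmul_add_right: "pmul p (q + q') = pmul p q + pmul p q'"
  by (simp add: pmul_def fun_eq_iff algebra_simps sum.distrib)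
lemma pmul_diff_left: "pmul (p - p') q = pmul p q - pmul p' q"
  by (simp add: pmul_def fun_eq_iff algebra_simps sum_subtractf)
lemma pmul_diff_right: "pmul p (q - q') = pmul p q - pmul p q'"
  by (simp add: pmul_def fun_eq_iff algebra_simps sum_subtractf)
lemma pmul_smult_left: "pmul (psmult c p) q = psmult c (pmul p q)"
  by (simp add: pmul_def psmult_def fun_eq_iff sum_distrib_left mult.assoc)
lemma pmul_smult_right: "pmul p (psmult c q) = psmult c (pmul p q)"
  by (simp add: pmul_def psmult_def fun_eq_iff sum_distrib_left algebra_simps)

lemma pmul_assoc: "pmul (pmul p q) r = pmul p (pmul q r)"
proof
  fix w show "pmul (pmul p q) r w = pmul p (pmul q r) w"
  proof (induction w arbitrary: p)
    case (Cons g w)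
    have "(\<lambda>v. pmul p q (g # v)) = psmult (p []) (\<lambda>v. q (g # v)) + pmul (\<lambda>v. p (g # v)) q"
      by (simp add: fun_eq_iff psmult_def)
    then have "pmul (\<lambda>v. pmul p q (g # v)) r w
        = p [] * pmul (\<lambda>v. q (g # v)) r w + pmul (\<lambda>v. p (g # v)) (pmul q r) w"
      by (simp only: pmul_add_left pmul_smult_left Cons.IH plus_fun_apply)
        (simp add: psmult_def)
    then show ?case
      by (simp add: algebra_simps)
  qed simp
qed

lemma br_eq: "br p q = pmul p q - pmul q p"
  by (simp add: br_def psub_eq)

interpretation elt: lie_algebra psmult br
proof
  show "psmult c (x + y) = psmult c x + psmult c y" "psmult (c + c') x = psmult c x + psmult c' x"
    "psmult c (psmult c' x) = psmult (c * c') x" "psmult 1 x = x" for c c' x y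
    by (auto simp: psmult_def fun_eq_iff algebra_simps)
  show "br (x + y) z = br x z + br y z" for x y z
    by (simp add: br_eq pmul_add_left pmul_add_right)
  show "br (psmult c x) z = psmult c (br x z)" for c x z
    by (simp add: br_eq pmul_smult_left pmul_smult_right)
      (simp add: psmult_def fun_eq_iff right_diff_distrib)
  show "br x x = 0" "br x y = - br y x" for x y
    by (simp_all add: br_eq)
  show "br x (br y z) = br (br x y) z + br y (br x z)" for x y z
    by (simp add: br_eq pmul_diff_left pmul_diff_right pmul_assoc)
qed

lemma ad_pow_0 [simp]: "ad_pow x 0 y = y"
  by (simp add: ad_pow_def)
lemma ad_pow_Suc [simp]: "ad_pow x (Suc n) y = br x (ad_pow x n y)"
  by (simp add: ad_pow_def)

section \<open>Generated Lie subalgebras and ideals\<close>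

lemma subspace_lie_gen: "elt.subspace (lie_gen S)"
  using lie_gen.zero lie_gen.add lie_gen.smult
  by (auto simp: elt.subspace_def elt_eqs)

lemma subspace_lie_ideal: "elt.subspace (lie_ideal L R)"
  using lie_ideal.zero lie_ideal.add lie_ideal.smult
  by (auto simp: elt.subspace_def elt_eqs)

lemma lie_gen_least:
  assumes "x \<in> lie_gen S" and S: "S \<subseteq> T" and T: "elt.subspace T"
    and br: "\<And>x y. x \<in> T \<Longrightarrow> y \<in> T \<Longrightarrow> br x y \<in> T"
  shows "x \<in> T"
  using assms(1)
proof induction
  case zero
  show "pzero \<in> T" using elt.subspace_0[OF T] by (simp add: pzero_eq)
next
  case (add x y)
  show "padd x y \<in> T" using add.IH T by (simp add: padd_eq elt.subspace_add)
qed (use S br elt.subspace_scale[OF T] in auto)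

text \<open>By Jacobi, the elements whose adjoint action preserves \<open>T\<close> are closed under
  brackets.\<close>

lemma lie_gen_stable:
  assumes S: "\<And>s z. s \<in> S \<Longrightarrow> z \<in> T \<Longrightarrow> br s z \<in> T" and T: "elt.subspace T"
    and "x \<in> lie_gen S" "z \<in> T"
  shows "br x z \<in> T"
  using assms(3,4)
proof (induction arbitrary: z)
  case zero
  show "br pzero z \<in> T" using elt.subspace_0[OF T] by (simp add: pzero_eq)
next
  case (add x y)
  show "br (padd x y) z \<in> T" using add elt.subspace_add[OF T] by (simp add: padd_eq elt.bracket_add_left)
next
  case (smult x c)
  show "br (psmult c x) z \<in> T" using smult elt.subspace_scale[OF T] by (simp add: elt.bracket_scale_left)
next
  case (brk x y)
  have "br x (br y z) - br y (br x z) \<in> T"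
    by (intro elt.subspace_diff[OF T] brk.IH brk.prems)
  then show "br (br x y) z \<in> T" using elt.jacobi[of x y z] by simp
qed (use S in auto)

text \<open>Iterated brackets of generators span the subalgebra, so \<open>T\<close> need not be
  closed under all brackets. This is the induction suited to graded statements, which are controlled
  only against one generator at a time.\<close>

lemma lie_gen_induct_ad:
  assumes "x \<in> lie_gen S" and S: "S \<subseteq> T" and T: "elt.subspace T"
    and st: "\<And>s z. s \<in> S \<Longrightarrow> z \<in> T \<Longrightarrow> br s z \<in> T"
  shows "x \<in> T"
  using assms(1)
proof induction
  case zero
  show "pzero \<in> T" using elt.subspace_0[OF T] by (simp add: pzero_eq)
next
  case (add x y)
  show "padd x y \<in> T" using add.IH T by (simp add: padd_eq elt.subspace_add)
next
  case (brk x y)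
  show "br x y \<in> T" using lie_gen_stable[OF st T brk.hyps(1) brk.IH(2)] .
qed (use S elt.subspace_scale[OF T] in auto)

text \<open>\<open>br x\<close> is a derivation, hence determined by its values on generators. The
  intended \<open>x\<close> is a Cartan element, which may lie outside the subalgebra.\<close>

lemma lie_gen_derivation:
  assumes S: "\<And>s. s \<in> S \<Longrightarrow> br x s \<in> lie_gen S" and "y \<in> lie_gen S"
  shows "br x y \<in> lie_gen S"
  using assms(2)
proof induction
  case zero
  show "br x pzero \<in> lie_gen S" using lie_gen.zero[of S] by (simp add: pzero_eq)
next
  case (add y z)
  show "br x (padd y z) \<in> lie_gen S"
    using lie_gen.add[OF add.IH] by (simp add: padd_eq elt.bracket_add_right)
next
  case (smult y c)
  show "br x (psmult c y) \<in> lie_gen S"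
    using lie_gen.smult[OF smult.IH] by (simp add: elt.bracket_scale_right)
next
  case (brk y z)
  have "br (br x y) z + br y (br x z) \<in> lie_gen S"
    using lie_gen.add[OF lie_gen.brk[OF brk.IH(1) brk.hyps(2)] lie_gen.brk[OF brk.hyps(1) brk.IH(2)]]
    by (simp add: padd_eq)
  then show "br x (br y z) \<in> lie_gen S" by (simp only: elt.jacobi[of x y z])
qed (use S in auto)

section \<open>Local actions on multilinear functions\<close>

definition sh :: "'a \<Rightarrow> ('a list \<Rightarrow> complex) \<Rightarrow> 'a list \<Rightarrow> complex" where
  "sh t P = (\<lambda>ts. P (t # ts))"

text \<open>The tensor product of \<open>P\<close> and \<open>Q\<close> in which \<open>P\<close>
  reads exactly the first \<open>n\<close> entries; its components of other lengths are ignored, and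
  lists shorter than \<open>n\<close> give 0.\<close>

fun tens :: "nat \<Rightarrow> ('a list \<Rightarrow> complex) \<Rightarrow> ('a list \<Rightarrow> complex) \<Rightarrow> 'a list \<Rightarrow> complex" where
  "tens 0 P Q ts = P [] * Q ts"
| "tens (Suc n) P Q [] = 0"
| "tens (Suc n) P Q (t # ts) = tens n (sh t P) Q ts"

text \<open>The quotient L/I is handled through representatives: its elements are elements of
  \<open>L\<close>, and equality in it is membership of the difference in \<open>I\<close>.\<close>

locale lie_pair = lie_algebra scale bracket
  for scale :: "complex \<Rightarrow> 'a::ab_group_add \<Rightarrow> 'a" and bracket +
  fixes L I :: "'a set"
  assumes subspace_L: "subspace L" and bracket_L: "x \<in> L \<Longrightarrow> y \<in> L \<Longrightarrow> bracket x y \<in> L"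
    and subspace_I: "subspace I" and I_subset: "I \<subseteq> L"
    and bracket_I: "x \<in> L \<Longrightarrow> y \<in> I \<Longrightarrow> bracket x y \<in> I"
begin

lemma bracket_I_left: "x \<in> I \<Longrightarrow> y \<in> L \<Longrightarrow> bracket x y \<in> I"
  using bracket_I[of y x] subspace_neg[OF subspace_I] by (simp add: bracket_anti[of x y])

lemmas L_closed = subspace_0[OF subspace_L] subspace_add[OF subspace_L] subspace_diff[OF subspace_L]
  subspace_neg[OF subspace_L] subspace_scale[OF subspace_L] bracket_L
lemmas I_closed = subspace_0[OF subspace_I] subspace_add[OF subspace_I] subspace_diff[OF subspace_I]
  subspace_neg[OF subspace_I] subspace_scale[OF subspace_I] bracket_I bracket_I_left

text \<open>Linearity on \<^term>\<open>L\<close> and vanishing on \<^term>\<open>I\<close>, rolled into one condition.\<close>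

definition slot_linear :: "('a \<Rightarrow> complex) \<Rightarrow> bool" where
  "slot_linear \<phi> \<longleftrightarrow>
    (\<forall>p\<in>L. \<forall>q\<in>L. \<forall>r\<in>L. \<forall>c. p - (q + scale c r) \<in> I \<longrightarrow> \<phi> p = \<phi> q + c * \<phi> r)"

text \<open>Lists of all lengths are allowed: this is the full dual of the tensor algebra of L/I,
  since \<open>sh\<close> and \<open>contract\<close> shift the length.\<close>

definition multilinear :: "('a list \<Rightarrow> complex) \<Rightarrow> bool" where
  "multilinear P \<longleftrightarrow> (\<forall>us\<in>lists L. \<forall>ts\<in>lists L. slot_linear (\<lambda>t. P (us @ t # ts)))"

text \<open>Nothing is assumed about entries outside \<open>L\<close>, so identities between
  multilinear functions can hold only on lists over \<open>L\<close>.\<close>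

definition agree :: "('a list \<Rightarrow> complex) \<Rightarrow> ('a list \<Rightarrow> complex) \<Rightarrow> bool" where
  "agree P Q \<longleftrightarrow> (\<forall>ts\<in>lists L. P ts = Q ts)"

lemma slot_linearD:
  "slot_linear \<phi> \<Longrightarrow> p \<in> L \<Longrightarrow> q \<in> L \<Longrightarrow> r \<in> L \<Longrightarrow> p - (q + scale c r) \<in> I \<Longrightarrow> \<phi> p = \<phi> q + c * \<phi> r"
  by (simp add: slot_linear_def)

lemma slot_linear_zero: "slot_linear \<phi> \<Longrightarrow> x \<in> I \<Longrightarrow> \<phi> x = 0"
  using slot_linearD[of \<phi> x 0 0 0] slot_linearD[of \<phi> 0 0 0 1] I_subset L_closed I_closed by auto

lemma slot_linear_add: "slot_linear \<phi> \<Longrightarrow> x \<in> L \<Longrightarrow> y \<in> L \<Longrightarrow> \<phi> (x + y) = \<phi> x + \<phi> y"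
  using slot_linearD[of \<phi> "x + y" x y 1] L_closed I_closed by auto

lemma slot_linear_scale: "slot_linear \<phi> \<Longrightarrow> x \<in> L \<Longrightarrow> \<phi> (scale c x) = c * \<phi> x"
  using slot_linearD[of \<phi> "scale c x" 0 x c] slot_linear_zero[of \<phi> 0] L_closed I_closed by auto

lemma slot_linear_minus: "slot_linear \<phi> \<Longrightarrow> x \<in> L \<Longrightarrow> \<phi> (- x) = - \<phi> x"
  using slot_linear_scale[of \<phi> x "-1"] by simp

lemma slot_linear_comb:
  "slot_linear \<phi> \<Longrightarrow> slot_linear \<psi> \<Longrightarrow> slot_linear (\<lambda>t. \<phi> t + c * \<psi> t)"
  unfolding slot_linear_def by (simp add: algebra_simps)

lemma slot_linear_sum:
  "slot_linear \<phi> \<Longrightarrow> slot_linear \<psi> \<Longrightarrow> slot_linear (\<lambda>t. \<phi> t + \<psi> t)"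
  using slot_linear_comb[of \<phi> \<psi> 1] by simp

lemma slot_linear_bracket: "slot_linear \<phi> \<Longrightarrow> x \<in> L \<Longrightarrow> slot_linear (\<lambda>t. \<phi> (bracket x t))"
  unfolding slot_linear_def
proof (intro ballI allI impI)
  fix p q r c
  assume \<phi>: "\<forall>p\<in>L. \<forall>q\<in>L. \<forall>r\<in>L. \<forall>c. p - (q + scale c r) \<in> I \<longrightarrow> \<phi> p = \<phi> q + c * \<phi> r"
    and x: "x \<in> L" and L: "p \<in> L" "q \<in> L" "r \<in> L" and "p - (q + scale c r) \<in> I"
  then have "bracket x (p - (q + scale c r)) \<in> I" by (intro bracket_I)
  then have "bracket x p - (bracket x q + scale c (bracket x r)) \<in> I"
    by (simp add: bracket_linear)
  with \<phi> x L bracket_L show "\<phi> (bracket x p) = \<phi> (bracket x q) + c * \<phi> (bracket x r)" by blast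
qed

lemma multilinearD:
  "multilinear P \<Longrightarrow> us \<in> lists L \<Longrightarrow> ts \<in> lists L \<Longrightarrow> slot_linear (\<lambda>t. P (us @ t # ts))"
  by (simp add: multilinear_def)

lemma multilinear_head: "multilinear P \<Longrightarrow> ts \<in> lists L \<Longrightarrow> slot_linear (\<lambda>t. P (t # ts))"
  using multilinearD[of P "[]" ts] by simp

lemma multilinear_sh: "multilinear P \<Longrightarrow> t \<in> L \<Longrightarrow> multilinear (sh t P)"
  using multilinearD[of P "t # us" for us] by (simp add: multilinear_def sh_def)

lemma multilinearI:
  assumes "\<And>ts. ts \<in> lists L \<Longrightarrow> slot_linear (\<lambda>t. P (t # ts))"
    and "\<And>t. t \<in> L \<Longrightarrow> multilinear (sh t P)"
  shows "multilinear P"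
  unfolding multilinear_def
proof (intro ballI)
  fix us ts assume "us \<in> lists L" "ts \<in> lists L"
  then show "slot_linear (\<lambda>t. P (us @ t # ts))"
    using assms by (cases us) (auto simp: multilinear_def sh_def)
qed

lemma multilinear_comb:
  "multilinear P \<Longrightarrow> multilinear Q \<Longrightarrow> multilinear (\<lambda>ts. P ts + c * Q ts)"
  unfolding multilinear_def by (auto intro!: slot_linear_comb)

lemma multilinear_0: "multilinear (\<lambda>ts. 0)"
  unfolding multilinear_def slot_linear_def by simp

lemma agree_refl: "agree P P"
  by (simp add: agree_def)

lemma agree_sh: "agree P Q \<Longrightarrow> t \<in> L \<Longrightarrow> agree (sh t P) (sh t Q)"
  by (simp add: agree_def sh_def)

text \<open>Linearity in the first slot, phrased as an agreement of functions: any operator that is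
  linear and respects \<open>agree\<close> then inherits linearity in that slot.\<close>

lemma sh_slot:
  assumes "multilinear P" "p \<in> L" "q \<in> L" "r \<in> L" "p - (q + scale c r) \<in> I"
  shows "agree (sh p P) (\<lambda>ts. sh q P ts + c * sh r P ts)"
  unfolding agree_def sh_def using slot_linearD[OF multilinear_head] assms by auto

text \<open>The three local actions, transposed from the tensor algebra of \<open>L / I\<close> to multilinear
  functions: \<^const>\<open>sh\<close> is dual to left multiplication, \<open>dact\<close> to the derivation induced by the
  adjoint action, and \<open>contract u\<close> to the operator \<open>\<phi>\<close> with
  \<open>\<phi> 1 = 0\<close> and \<open>\<phi> (t \<otimes> w) = [u, t] \<cdot> w + t \<otimes> \<phi> w\<close>.\<close>

fun dact :: "'a \<Rightarrow> ('a list \<Rightarrow> complex) \<Rightarrow> 'a list \<Rightarrow> complex" where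
  "dact x P [] = 0"
| "dact x P (t # ts) = P (bracket x t # ts) + dact x (sh t P) ts"

fun contract :: "'a \<Rightarrow> ('a list \<Rightarrow> complex) \<Rightarrow> 'a list \<Rightarrow> complex" where
  "contract u P [] = 0"
| "contract u P (t # ts) = dact (bracket u t) P ts + contract u (sh t P) ts"

lemma sh_comb: "sh t (\<lambda>ts. P ts + c * Q ts) = (\<lambda>ts. sh t P ts + c * sh t Q ts)"
  by (simp add: sh_def)

lemma sh_sum: "sh t (\<lambda>ts. \<Sum>u\<in>A. c u * Q u ts) = (\<lambda>ts. \<Sum>u\<in>A. c u * sh t (Q u) ts)"
  by (simp add: sh_def)

lemma dact_sum: "dact x (\<lambda>ts. \<Sum>u\<in>A. c u * Q u ts) ts = (\<Sum>u\<in>A. c u * dact x (Q u) ts)"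
  by (induction ts arbitrary: Q) (simp_all add: sh_sum sum.distrib distrib_left)

lemma contract_sum: "contract x (\<lambda>ts. \<Sum>u\<in>A. c u * Q u ts) ts = (\<Sum>u\<in>A. c u * contract x (Q u) ts)"
  by (induction ts arbitrary: Q) (simp_all add: sh_sum dact_sum sum.distrib distrib_left)

lemma dact_comb: "dact x (\<lambda>ts. P ts + c * Q ts) ts = dact x P ts + c * dact x Q ts"
  by (induction ts arbitrary: P Q) (simp_all add: sh_comb algebra_simps)

lemma contract_comb: "contract x (\<lambda>ts. P ts + c * Q ts) ts = contract x P ts + c * contract x Q ts"
  by (induction ts arbitrary: P Q) (simp_all add: sh_comb dact_comb algebra_simps)

lemma dact_add: "dact x (\<lambda>ts. P ts + Q ts) ts = dact x P ts + dact x Q ts"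
  using dact_comb[of x P 1 Q ts] by simp

lemma contract_add: "contract x (\<lambda>ts. P ts + Q ts) ts = contract x P ts + contract x Q ts"
  using contract_comb[of x P 1 Q ts] by simp

lemma dact_cong: "agree P Q \<Longrightarrow> x \<in> L \<Longrightarrow> agree (dact x P) (dact x Q)"
proof -
  have "dact x P ts = dact x Q ts" if "agree P Q" "x \<in> L" "ts \<in> lists L" for ts
    using that(3,1)
  proof (induction ts arbitrary: P Q)
    case (Cons t ts)
    then show ?case using Cons.IH[OF agree_sh] bracket_L[OF \<open>x \<in> L\<close>, of t]
      by (simp add: agree_def)
  qed simp
  then show "agree P Q \<Longrightarrow> x \<in> L \<Longrightarrow> agree (dact x P) (dact x Q)" by (simp add: agree_def)
qed

lemma contract_cong: "agree P Q \<Longrightarrow> x \<in> L \<Longrightarrow> agree (contract x P) (contract x Q)"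
proof -
  have "contract x P ts = contract x Q ts" if "agree P Q" "x \<in> L" "ts \<in> lists L" for ts
    using that(3,1)
  proof (induction ts arbitrary: P Q)
    case (Cons t ts)
    then show ?case
      using Cons.IH[OF agree_sh] dact_cong[OF Cons.prems bracket_L[OF \<open>x \<in> L\<close>, of t]]
      by (simp add: agree_def)
  qed simp
  then show "agree P Q \<Longrightarrow> x \<in> L \<Longrightarrow> agree (contract x P) (contract x Q)" by (simp add: agree_def)
qed

lemma dact_slot_sh: "x \<in> L \<Longrightarrow> multilinear P \<Longrightarrow> ts \<in> lists L \<Longrightarrow> slot_linear (\<lambda>t. dact x (sh t P) ts)"
  unfolding slot_linear_def
  using dact_cong[OF sh_slot] by (auto simp: agree_def dact_comb)

lemma contract_slot_sh: "x \<in> L \<Longrightarrow> multilinear P \<Longrightarrow> ts \<in> lists L \<Longrightarrow> slot_linear (\<lambda>t. contract x (sh t P) ts)"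
  unfolding slot_linear_def
  using contract_cong[OF sh_slot] by (auto simp: agree_def contract_comb)

lemma multilinear_dact:
  assumes x: "x \<in> L" and "multilinear P"
  shows "multilinear (dact x P)"
proof -
  have "slot_linear (\<lambda>t. dact x P (us @ t # ts))" if "us \<in> lists L" "ts \<in> lists L" for us ts
    using that(1) assms(2)
  proof (induction us arbitrary: P)
    case Nil
    then show ?case
      using slot_linear_sum[OF slot_linear_bracket[OF multilinear_head[OF Nil.prems that(2)] x]
          dact_slot_sh[OF x Nil.prems that(2)]] by simp
  next
    case (Cons u us)
    have "slot_linear (\<lambda>t. P ((bracket x u # us) @ t # ts))"
      using Cons.hyps that(2) bracket_L[OF x] by (intro multilinearD[OF Cons.prems]) auto
    then show ?case
      using slot_linear_sum[OF _ Cons.IH[OF multilinear_sh[OF Cons.prems Cons.hyps(1)]]] by simp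
  qed
  then show ?thesis by (simp add: multilinear_def)
qed

lemma dact_slot: "multilinear P \<Longrightarrow> ts \<in> lists L \<Longrightarrow> slot_linear (\<lambda>x. dact x P ts)"
  unfolding slot_linear_def
proof (intro ballI allI impI)
  fix p q r c
  assume P: "multilinear P" and ts: "ts \<in> lists L" and L: "p \<in> L" "q \<in> L" "r \<in> L"
    and I: "p - (q + scale c r) \<in> I"
  show "dact p P ts = dact q P ts + c * dact r P ts"
    using ts P
  proof (induction ts arbitrary: P)
    case (Cons t ts)
    have "bracket (p - (q + scale c r)) t \<in> I" using I Cons.hyps by (intro bracket_I_left)
    then have "P (bracket p t # ts) = P (bracket q t # ts) + c * P (bracket r t # ts)"
      using slot_linearD[OF multilinear_head[OF Cons.prems], of ts "bracket p t" "bracket q t" "bracket r t" c]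
        Cons.hyps L bracket_L by (auto simp: bracket_linear)
    then show ?case using Cons.IH[OF multilinear_sh[OF Cons.prems Cons.hyps(1)]]
      by (simp add: algebra_simps)
  qed simp
qed

lemma bracket_left_slot:
  "slot_linear (\<lambda>x. \<phi> x) \<Longrightarrow> t \<in> L \<Longrightarrow> slot_linear (\<lambda>x. \<phi> (bracket x t))"
proof -
  assume \<phi>: "slot_linear (\<lambda>x. \<phi> x)" and t: "t \<in> L"
  have "slot_linear (\<lambda>x. \<phi> (bracket t x) * (-1))"
    using slot_linear_bracket[OF \<phi> t] by (simp add: slot_linear_def algebra_simps)
  moreover have "\<phi> (bracket x t) = \<phi> (bracket t x) * (-1)" if "x \<in> L" for x
    using slot_linear_minus[OF \<phi>, of "bracket t x"] that t bracket_L by (simp add: bracket_anti[of x t])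
  ultimately show ?thesis by (simp add: slot_linear_def)
qed

lemma contract_slot: "multilinear P \<Longrightarrow> ts \<in> lists L \<Longrightarrow> slot_linear (\<lambda>x. contract x P ts)"
proof -
  assume P: "multilinear P" and ts: "ts \<in> lists L"
  show ?thesis using ts P
  proof (induction ts arbitrary: P)
    case Nil show ?case by (simp add: slot_linear_def)
  next
    case (Cons t ts)
    have "slot_linear (\<lambda>x. dact (bracket x t) P ts)"
      using bracket_left_slot[OF dact_slot[OF Cons.prems]] Cons.hyps by blast
    then show ?case
      using slot_linear_sum[OF _ Cons.IH[OF multilinear_sh[OF Cons.prems Cons.hyps(1)]]] by simp
  qed
qed

lemma multilinear_contract:
  assumes x: "x \<in> L" and "multilinear P"
  shows "multilinear (contract x P)"
proof -
  have "slot_linear (\<lambda>t. contract x P (us @ t # ts))" if "us \<in> lists L" "ts \<in> lists L" for us ts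
    using that(1) assms(2)
  proof (induction us arbitrary: P)
    case Nil
    then show ?case
      using slot_linear_sum[OF slot_linear_bracket[OF dact_slot[OF Nil.prems that(2)] x]
          contract_slot_sh[OF x Nil.prems that(2)]] by simp
  next
    case (Cons u us)
    have "slot_linear (\<lambda>t. dact (bracket x u) P (us @ t # ts))"
      using multilinear_dact[OF bracket_L[OF x Cons.hyps(1)] Cons.prems] Cons.hyps that(2)
      by (intro multilinearD) auto
    then show ?case
      using slot_linear_sum[OF _ Cons.IH[OF multilinear_sh[OF Cons.prems Cons.hyps(1)]]] by simp
  qed
  then show ?thesis by (simp add: multilinear_def)
qed

lemma sh_dact: "sh v (dact x P) = (\<lambda>ts. sh (bracket x v) P ts + dact x (sh v P) ts)"
  by (simp add: sh_def fun_eq_iff)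

lemma sh_contract: "sh v (contract u P) = (\<lambda>ts. dact (bracket u v) P ts + contract u (sh v P) ts)"
  by (simp add: sh_def fun_eq_iff)

lemma dact_dact:
  assumes x: "x \<in> L" and y: "y \<in> L" and "multilinear P" and "ts \<in> lists L"
  shows "dact y (dact x P) ts - dact x (dact y P) ts = dact (bracket x y) P ts"
  using assms(4,3)
proof (induction ts arbitrary: P)
  case (Cons t ts)
  have m: "multilinear (sh t P)" using multilinear_sh Cons by blast
  have h: "slot_linear (\<lambda>t. P (t # ts))" using multilinear_head Cons by blast
  have "P (bracket x (bracket y t) # ts) = P (bracket (bracket x y) t # ts) + P (bracket y (bracket x t) # ts)"
    unfolding jacobi[of x y t] by (rule slot_linear_add[OF h]) (use Cons x y bracket_L in auto)
  then show ?case using Cons.IH[OF m]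
    by (simp add: sh_dact dact_add sh_def algebra_simps)
qed simp

lemma contract_dact:
  assumes x: "x \<in> L" and u: "u \<in> L" and "multilinear P" and "ts \<in> lists L"
  shows "contract u (dact x P) ts - dact x (contract u P) ts = contract (bracket x u) P ts"
  using assms(4,3)
proof (induction ts arbitrary: P)
  case (Cons t ts)
  have t: "t \<in> L" and ts: "ts \<in> lists L" using Cons by auto
  have m: "multilinear (sh t P)" using multilinear_sh Cons by blast
  have h: "slot_linear (\<lambda>x. dact x P ts)" using dact_slot Cons by blast
  have "dact (bracket x (bracket u t)) P ts = dact (bracket (bracket x u) t) P ts + dact (bracket u (bracket x t)) P ts"
    unfolding jacobi[of x u t] by (rule slot_linear_add[OF h]) (use t x u bracket_L in auto)
  then show ?case
    using Cons.IH[OF m] dact_dact[OF x bracket_L[OF u t] Cons.prems ts]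
    by (simp add: sh_dact sh_contract dact_add contract_add algebra_simps)
qed simp

text \<open>Every index other than 0 and 1 selects the contraction; the intended one is -1.\<close>

definition loc :: "int \<Rightarrow> 'a \<Rightarrow> ('a list \<Rightarrow> complex) \<Rightarrow> 'a list \<Rightarrow> complex" where
  "loc m x P = (if m = 1 then sh x P else if m = 0 then dact x P else contract x P)"

lemma loc_slot: "multilinear P \<Longrightarrow> ts \<in> lists L \<Longrightarrow> slot_linear (\<lambda>x. loc m x P ts)"
  using multilinear_head[of P ts] dact_slot[of P ts] contract_slot[of P ts]
  by (cases "m = 1"; cases "m = 0") (auto simp: loc_def sh_def)

lemma multilinear_loc: "x \<in> L \<Longrightarrow> multilinear P \<Longrightarrow> multilinear (loc m x P)"
  by (simp add: loc_def multilinear_sh multilinear_dact multilinear_contract)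

lemma loc_cong: "agree P Q \<Longrightarrow> x \<in> L \<Longrightarrow> agree (loc m x P) (loc m x Q)"
  by (simp add: loc_def agree_sh dact_cong contract_cong)

lemma loc_comb: "loc m x (\<lambda>ts. P ts + c * Q ts) ts = loc m x P ts + c * loc m x Q ts"
  by (simp add: loc_def sh_comb dact_comb contract_comb)

lemma loc_sum: "loc m x (\<lambda>ts. \<Sum>u\<in>A. c u * Q u ts) ts = (\<Sum>u\<in>A. c u * loc m x (Q u) ts)"
  by (simp add: loc_def sh_sum dact_sum contract_sum)

text \<open>The composition order is reversed because the operators are transposes. Antisymmetry
  leaves \<open>m = 0\<close> with any \<open>n\<close>, and the pair -1, 1. These are the
  identities \<open>sh_dact\<close>, \<open>dact_dact\<close>, \<open>contract_dact\<close> and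
  \<open>sh_contract\<close>. Nothing is claimed for two elements of degree 1 or two of degree
  -1.\<close>

lemma loc_bracket:
  assumes x: "x \<in> L" and y: "y \<in> L" and P: "multilinear P" and ts: "ts \<in> lists L"
    and mn: "m \<in> {-1,0,1}" "n \<in> {-1,0,1}" "m + n \<in> {-1,0,1}"
  shows "loc (m + n) (bracket x y) P ts = loc n y (loc m x P) ts - loc m x (loc n y P) ts"
proof -
  have pos: "loc (m + n) (bracket x y) P ts = loc n y (loc m x P) ts - loc m x (loc n y P) ts"
    if "x \<in> L" "y \<in> L" "m = 0 \<or> m = -1 \<and> n = 1" "n \<in> {-1,0,1}" for x y m n
    using that contract_dact[OF that(1,2) P ts] dact_dact[OF that(1,2) P ts]
    by (auto simp: loc_def sh_dact sh_contract)
  consider "m = 0 \<or> m = -1 \<and> n = 1" | "n = 0 \<or> n = -1 \<and> m = 1" using mn by auto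
  then show ?thesis
  proof cases
    case 1 then show ?thesis using pos[OF x y] mn by blast
  next
    case 2
    then have "loc (n + m) (bracket y x) P ts = loc m x (loc n y P) ts - loc n y (loc m x P) ts"
      using pos[OF y x] mn by blast
    then show ?thesis
      using slot_linear_minus[OF loc_slot[OF P ts], of "bracket y x" "m + n"] bracket_L[OF y x]
      by (simp add: bracket_anti[of x y] add.commute)
  qed
qed

lemma tens_comb:
  "tens n (\<lambda>ts. P ts + c * P' ts) Q ts = tens n P Q ts + c * tens n P' Q ts"
  by (induction n P Q ts arbitrary: P' rule: tens.induct) (simp_all add: sh_comb distrib_right mult.assoc)

lemma tens_zero: "tens n (\<lambda>ts. 0) Q ts = 0"
  using tens_comb[of n "\<lambda>ts. 0" 1 "\<lambda>ts. 0" Q ts] by simp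

lemma tens_cong: "agree P P' \<Longrightarrow> ts \<in> lists L \<Longrightarrow> tens n P Q ts = tens n P' Q ts"
proof (induction n arbitrary: P P' ts)
  case 0 then show ?case by (simp add: agree_def)
next
  case (Suc n)
  show ?case using Suc.prems Suc.IH[OF agree_sh[OF Suc.prems(1)]] by (cases ts) auto
qed

lemma sh_tens: "sh t (tens (Suc n) P Q) = tens n (sh t P) Q"
  by (simp add: sh_def fun_eq_iff)

lemma multilinear_tens: "multilinear P \<Longrightarrow> multilinear Q \<Longrightarrow> multilinear (tens n P Q)"
proof (induction n arbitrary: P)
  case 0
  then show ?case using multilinear_comb[OF multilinear_0 0(2), of "P []"] by (simp add: multilinear_def)
next
  case (Suc n)
  show ?case
  proof (rule multilinearI)
    fix ts assume ts: "ts \<in> lists L"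
    show "slot_linear (\<lambda>t. tens (Suc n) P Q (t # ts))"
      unfolding slot_linear_def
      using tens_cong[OF sh_slot[OF Suc.prems(1)] ts] by (auto simp: tens_comb)
  next
    fix t assume "t \<in> L"
    then show "multilinear (sh t (tens (Suc n) P Q))"
      using Suc multilinear_sh by (simp add: sh_tens)
  qed
qed

end

section \<open>Actions of the whole Lie algebra and their local part\<close>

locale local_action = lie_pair scale bracket L I
  for scale :: "complex \<Rightarrow> 'a::ab_group_add \<Rightarrow> 'a" and bracket L I +
  fixes act :: "'a \<Rightarrow> ('a list \<Rightarrow> complex) \<Rightarrow> 'a list \<Rightarrow> complex"
  assumes act_add: "x \<in> L \<Longrightarrow> y \<in> L \<Longrightarrow> act (x + y) P ts = act x P ts + act y P ts"
    and act_scale: "x \<in> L \<Longrightarrow> act (scale c x) P ts = c * act x P ts"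
    and act_comb: "x \<in> L \<Longrightarrow> act x (\<lambda>ts. P ts + c * Q ts) ts = act x P ts + c * act x Q ts"
    and act_cong: "x \<in> L \<Longrightarrow> agree P Q \<Longrightarrow> agree (act x P) (act x Q)"
    and multilinear_act: "x \<in> L \<Longrightarrow> multilinear P \<Longrightarrow> multilinear (act x P)"
    and act_bracket: "x \<in> L \<Longrightarrow> y \<in> L \<Longrightarrow>
      act (bracket x y) P ts = act y (act x P) ts - act x (act y P) ts"
begin

lemma act_0 [simp]: "x \<in> L \<Longrightarrow> act x (\<lambda>ts. 0) ts = 0"
  using act_comb[of x "\<lambda>ts. 0" 1 "\<lambda>ts. 0" ts] by simp

lemma act_scale_arg: "x \<in> L \<Longrightarrow> act x (\<lambda>ts. c * P ts) ts = c * act x P ts"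
  using act_comb[of x "\<lambda>ts. 0" c P ts] by simp

text \<open>A substitute for the degree \<open>m\<close> part that refers to the action instead of a
  grading; it is closed under the brackets that stay within degrees -1, 0, 1.\<close>

definition K :: "int \<Rightarrow> 'a set" where
  "K m = {x \<in> L. \<forall>P. multilinear P \<longrightarrow> agree (act x P) (loc m x P)}"

lemma KD: "x \<in> K m \<Longrightarrow> x \<in> L" "x \<in> K m \<Longrightarrow> multilinear P \<Longrightarrow> agree (act x P) (loc m x P)"
  by (auto simp: K_def)

lemma K_add: "x \<in> K m \<Longrightarrow> y \<in> K m \<Longrightarrow> x + y \<in> K m"
  using slot_linear_add[OF loc_slot] by (auto simp: K_def act_add agree_def L_closed)

lemma K_scale: "x \<in> K m \<Longrightarrow> scale c x \<in> K m"
  using slot_linear_scale[OF loc_slot] by (auto simp: K_def act_scale agree_def L_closed)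

lemma K_0: "0 \<in> K m"
proof -
  have "act 0 P ts = 0" for P ts using act_scale[of 0 0 P ts] L_closed by simp
  then show ?thesis using slot_linear_zero[OF loc_slot] by (auto simp: K_def agree_def L_closed I_closed)
qed

lemma subspace_K: "subspace (K m)"
  by (simp add: subspace_def K_add K_scale K_0)

lemma K_bracket:
  assumes x: "x \<in> K m" and y: "y \<in> K n"
    and mn: "m \<in> {-1,0,1}" "n \<in> {-1,0,1}" "m + n \<in> {-1,0,1}"
  shows "bracket x y \<in> K (m + n)"
proof -
  have "act (bracket x y) P ts = loc (m + n) (bracket x y) P ts" if P: "multilinear P" and ts: "ts \<in> lists L" for P ts
  proof -
    have *: "act v (act u P) ts = loc n v (loc m u P) ts" if "u \<in> K m" "v \<in> K n" for u v m n
      using act_cong[OF KD(1)[OF that(2)] KD(2)[OF that(1) P]]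
        KD(2)[OF that(2) multilinear_loc[OF KD(1)[OF that(1)] P]] ts by (simp add: agree_def)
    show ?thesis
      using loc_bracket[OF KD(1)[OF x] KD(1)[OF y] P ts mn] *[OF x y] *[OF y x] KD(1)[OF x] KD(1)[OF y]
      by (simp add: act_bracket)
  qed
  then show ?thesis using KD(1)[OF x] KD(1)[OF y] by (simp add: K_def agree_def L_closed)
qed

text \<open>The span of the right-nested n-fold brackets of elements of \<open>K \<sigma>\<close>,
  that is, degree \<sigma>n of the subalgebra generated by \<open>K \<sigma>\<close>.\<close>

inductive U :: "int \<Rightarrow> nat \<Rightarrow> 'a \<Rightarrow> bool" for \<sigma> where
  U_base: "x \<in> K \<sigma> \<Longrightarrow> U \<sigma> 1 x"
| U_step: "v \<in> K \<sigma> \<Longrightarrow> U \<sigma> n z \<Longrightarrow> U \<sigma> (Suc n) (bracket v z)"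
| U_add: "U \<sigma> n x \<Longrightarrow> U \<sigma> n y \<Longrightarrow> U \<sigma> n (x + y)"
| U_scale: "U \<sigma> n x \<Longrightarrow> U \<sigma> n (scale c x)"

lemma U_L: "U \<sigma> n x \<Longrightarrow> x \<in> L"
  by (induction rule: U.induct) (auto simp: L_closed KD(1))

lemma U_pos: "U \<sigma> n x \<Longrightarrow> n \<ge> 1"
  by (induction rule: U.induct) auto

lemma U_0: "n \<ge> 1 \<Longrightarrow> U \<sigma> n 0"
proof (induction n rule: nat_induct_at_least)
  case base then show ?case using U_base K_0 by blast
next
  case (Suc n) then show ?case using U_step[OF K_0 Suc.IH] by simp
qed

lemma K0_U: "U \<sigma> n x \<Longrightarrow> k \<in> K 0 \<Longrightarrow> \<sigma> \<in> {-1,1} \<Longrightarrow> U \<sigma> n (bracket k x)"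
proof (induction rule: U.induct)
  case (U_base x) then show ?case using K_bracket[of k 0 x \<sigma>] U.U_base by auto
next
  case (U_step v n z)
  then have "bracket k v \<in> K \<sigma>" using K_bracket[of k 0 v \<sigma>] by auto
  with U_step show ?case by (auto simp: jacobi[of k v z] intro!: U.intros)
next
  case (U_add n x y)
  then show ?case by (auto simp: bracket_linear intro: U.intros)
next
  case (U_scale n x c)
  then show ?case by (auto simp: bracket_linear intro: U.intros)
qed

text \<open>Jacobi moves \<open>k\<close> through a nested bracket until it meets a factor in
  \<open>K \<sigma>\<close> and produces an element of \<open>K 0\<close>, which \<open>K0_U\<close>
  absorbs. Length one drops to degree 0, where \<open>U\<close> has no member; hence the case
  distinction.\<close>

lemma Kneg_U:
  "U \<sigma> n x \<Longrightarrow> k \<in> K (- \<sigma>) \<Longrightarrow> \<sigma> \<in> {-1,1} \<Longrightarrow>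
    (if n = 1 then bracket k x \<in> K 0 else U \<sigma> (n - 1) (bracket k x))"
proof (induction rule: U.induct)
  case (U_base x) then show ?case using K_bracket[of k "-\<sigma>" x \<sigma>] by auto
next
  case (U_step v n z)
  then have kv: "bracket k v \<in> K 0" using K_bracket[of k "-\<sigma>" v \<sigma>] by auto
  have 1: "U \<sigma> n (bracket (bracket k v) z)" using K0_U U_step kv by blast
  have "U \<sigma> n (bracket v (bracket k z))"
  proof (cases "n = 1")
    case True
    then have "bracket k z \<in> K 0" using U_step by simp
    then have "bracket v (bracket k z) \<in> K \<sigma>" using K_bracket[of v \<sigma> "bracket k z" 0] U_step by auto
    then show ?thesis using True U.U_base by simp
  next
    case False
    then have "U \<sigma> (Suc (n - 1)) (bracket v (bracket k z))" using U.U_step U_step by auto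
    then show ?thesis using False U_pos[OF U_step.hyps(2)] by simp
  qed
  then show ?case using 1 U_pos[OF U_step.hyps(2)] by (auto simp: jacobi[of k v z] intro: U.U_add)
next
  case (U_add n x y)
  then show ?case by (auto simp: bracket_linear K_add intro: U.intros split: if_splits)
next
  case (U_scale n x c)
  then show ?case by (auto simp: bracket_linear K_scale intro: U.intros split: if_splits)
qed

definition W :: "int \<Rightarrow> 'a set" where
  "W m = (if m = 0 then K 0 else {x. U (sgn m) (nat \<bar>m\<bar>) x})"

text \<open>The spaces \<open>W m\<close> are thus closed under the local part. Everything generated
  by local elements therefore decomposes along them.\<close>

lemma W_bracket:
  assumes k: "k \<in> K j" and j: "j \<in> {-1,0,1}" and x: "x \<in> W m"
  shows "bracket k x \<in> W (m + j)"
proof -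
  consider "j = 0" | "m = 0" "j \<noteq> 0" | "m \<noteq> 0" "j = sgn m" | "m \<noteq> 0" "j = - sgn m"
    using j by (cases "m = 0"; cases "m > 0") auto
  then show ?thesis
  proof cases
    case 1
    then show ?thesis using x k K0_U[of "sgn m" _ x k] K_bracket[of k 0 x 0]
      by (auto simp: W_def sgn_if)
  next
    case 2
    then show ?thesis using x k K_bracket[of k j x 0] j
      by (auto simp: W_def intro: U_base[simplified])
  next
    case 3
    then have "sgn (m + j) = sgn m" "nat \<bar>m + j\<bar> = Suc (nat \<bar>m\<bar>)" "m + j \<noteq> 0"
      by (auto simp: sgn_if split: if_splits)
    then show ?thesis using 3 k x U_step[of k "sgn m" "nat \<bar>m\<bar>" x] by (simp add: W_def)
  next
    case 4
    show ?thesis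
    proof (cases "nat \<bar>m\<bar> = 1")
      case True
      then have "m + j = 0" using 4 by (auto simp: sgn_if split: if_splits)
      then show ?thesis using 4 k x True Kneg_U[of "sgn m" "nat \<bar>m\<bar>" x k]
        by (auto simp: W_def sgn_if split: if_splits)
    next
      case False
      then have "sgn (m + j) = sgn m" "nat \<bar>m + j\<bar> = nat \<bar>m\<bar> - 1" "m + j \<noteq> 0"
        using 4 by (auto simp: sgn_if split: if_splits)
      then show ?thesis using 4 k x False Kneg_U[of "sgn m" "nat \<bar>m\<bar>" x k]
        by (auto simp: W_def sgn_if)
    qed
  qed
qed

lemma subspace_W: "subspace (W m)"
  by (cases "m = 0") (auto simp: W_def subspace_K, auto simp: subspace_def intro: U_0 U_add U_scale)

text \<open>The Dynkin operator detects elements of \<^const>\<open>U\<close> that are nonzero modulo \<^term>\<open>I\<close>.\<close>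

fun nested :: "'a list \<Rightarrow> 'a" where
  "nested [] = 0"
| "nested [t] = t"
| "nested (t # ts) = bracket t (nested ts)"

lemma nested_Cons: "ts \<noteq> [] \<Longrightarrow> nested (t # ts) = bracket t (nested ts)"
  by (cases ts) auto

lemma nested_L: "ts \<in> lists L \<Longrightarrow> nested ts \<in> L"
  by (induction ts rule: nested.induct) (auto simp: L_closed)

definition dynkin :: "('a \<Rightarrow> complex) \<Rightarrow> 'a list \<Rightarrow> complex" where
  "dynkin f ts = (if ts = [] then 0 else f (nested ts))"

lemma multilinear_dynkin:
  assumes "slot_linear f"
  shows "multilinear (dynkin f)"
proof -
  have "slot_linear (\<lambda>t. f (nested (us @ t # ts)))" if "us \<in> lists L" "ts \<in> lists L" for us ts
    using that(1) assms
  proof (induction us arbitrary: f)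
    case Nil
    then show ?case
      using bracket_left_slot[OF Nil nested_L[OF that(2)]] by (cases "ts = []") (simp_all add: nested_Cons)
  next
    case (Cons u us)
    then show ?case
      using Cons.IH[OF slot_linear_bracket[OF Cons.prems Cons.hyps(1)]] by (simp add: nested_Cons)
  qed
  then show ?thesis by (simp add: multilinear_def dynkin_def)
qed

definition unit_fun :: "'a list \<Rightarrow> complex" where
  "unit_fun ts = (if ts = [] then 1 else 0)"

lemma multilinear_unit: "multilinear unit_fun"
  by (simp add: multilinear_def slot_linear_def unit_fun_def)

lemma sh_unit: "sh x unit_fun = (\<lambda>ts. 0)"
  by (simp add: sh_def unit_fun_def)

text \<open>Left multiplications produce only nonempty words, on which \<open>unit_fun\<close>
  vanishes.\<close>

lemma act_unit: "U 1 n x \<Longrightarrow> agree (act x unit_fun) (\<lambda>ts. 0)"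
proof (induction rule: U.induct)
  case (U_base x)
  then show ?case using KD(2)[OF U_base multilinear_unit] by (simp add: loc_def sh_unit)
next
  case (U_step v n z)
  have v: "agree (act v unit_fun) (\<lambda>ts. 0)"
    using KD(2)[OF U_step.hyps(1) multilinear_unit] by (simp add: loc_def sh_unit)
  show ?case
    using act_cong[OF U_L[OF U_step.hyps(2)] v] act_cong[OF KD(1)[OF U_step.hyps(1)] U_step.IH]
      KD(1)[OF U_step.hyps(1)] U_L[OF U_step.hyps(2)]
    by (simp add: agree_def act_bracket)
qed (auto simp: agree_def act_add act_scale U_L)

lemma sh_dynkin: "sh v (dynkin f) = (\<lambda>ts. if ts = [] then f v else f (bracket v (nested ts)))"
  by (auto simp: sh_def dynkin_def nested_Cons)

text \<open>The Dynkin-Specht-Wever identity in dual form. The factor \<open>n\<close> grows because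
  the commutator of \<open>v\<close> and \<open>z\<close> contributes
  \<open>n * f (bracket v z) - f (bracket z v)\<close> at the empty list. The value on nonempty
  lists is carried along since \<open>act v\<close> evaluates there.\<close>

lemma act_dynkin:
  "U 1 n x \<Longrightarrow> slot_linear f \<Longrightarrow>
    agree (act x (dynkin f)) (\<lambda>ts. if ts = [] then of_nat n * f x else f (bracket x (nested ts)))"
proof (induction arbitrary: f rule: U.induct)
  case (U_base x)
  then show ?case using KD(2)[OF U_base(1) multilinear_dynkin[OF U_base(2)]]
    by (auto simp: agree_def loc_def sh_dynkin)
next
  case (U_step v n z f)
  note v = KD(1)[OF U_step.hyps(1)] and z = U_L[OF U_step.hyps(2)]
  have vz: "f (bracket z v) = - f (bracket v z)"
    using slot_linear_minus[OF U_step.prems bracket_L[OF v z]] by (simp add: bracket_anti[of z v])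
  \<comment> \<open>On nonempty lists \<open>sh v (dynkin f)\<close> is a Dynkin functional again;
    the multiple of \<open>unit_fun\<close> repairs the empty list, where \<open>dynkin\<close> is 0
    by convention, and \<open>act_unit\<close> removes it afterwards.\<close>
  have 1: "agree (act v (dynkin f)) (\<lambda>ts. dynkin (\<lambda>t. f (bracket v t)) ts + f v * unit_fun ts)"
    using KD(2)[OF U_step.hyps(1) multilinear_dynkin[OF U_step.prems]]
    by (auto simp: agree_def loc_def sh_dynkin) (auto simp: dynkin_def unit_fun_def)
  have 2: "agree (act z (act v (dynkin f)))
      (\<lambda>ts. if ts = [] then of_nat n * f (bracket v z) else f (bracket v (bracket z (nested ts))))"
    using act_cong[OF z 1] act_unit[OF U_step.hyps(2)]
      U_step.IH[OF slot_linear_bracket[OF U_step.prems v]] z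
    by (simp add: agree_def act_comb)
  have 3: "agree (act v (act z (dynkin f)))
      (\<lambda>ts. if ts = [] then f (bracket z v) else f (bracket z (bracket v (nested ts))))"
    using KD(2)[OF U_step.hyps(1) multilinear_act[OF z multilinear_dynkin[OF U_step.prems]]]
      U_step.IH[OF U_step.prems] v
    by (auto simp: agree_def loc_def sh_def nested_Cons)
  show ?case unfolding agree_def
  proof
    fix ts assume ts: "ts \<in> lists L"
    have "f (bracket v (bracket z (nested ts)))
        = f (bracket (bracket v z) (nested ts)) + f (bracket z (bracket v (nested ts)))"
      unfolding jacobi[of v z] by (rule slot_linear_add[OF U_step.prems]) (use v z nested_L[OF ts] in \<open>auto simp: L_closed\<close>)
    then show "act (bracket v z) (dynkin f) ts =
        (if ts = [] then of_nat (Suc n) * f (bracket v z) else f (bracket (bracket v z) (nested ts)))"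
      using 2 3 ts vz v z by (simp add: agree_def act_bracket algebra_simps)
  qed
next
  case (U_add n x y)
  then show ?case
    using slot_linear_add[OF U_add.prems]
    by (auto simp: agree_def act_add U_L nested_L L_closed bracket_linear distrib_left)
next
  case (U_scale n x c)
  then show ?case
    using slot_linear_scale[OF U_scale.prems]
    by (auto simp: agree_def act_scale U_L nested_L L_closed bracket_linear)
qed

text \<open>This is where freeness enters: in the tensor algebra, a word beginning with \<open>v\<close> is killed by
  functionals \<open>P \<otimes> \<dots>\<close> with \<open>P\<close> vanishing on \<open>v \<otimes> \<dots>\<close>, so that only the term \<open>x \<otimes> \<dots> \<otimes> x \<otimes> v\<close>
  of \<open>(ad x)^n v\<close> survives the pairing with \<open>P \<otimes> \<dots> \<otimes> P \<otimes> g\<close>.\<close>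

lemma act_tens:
  "U 1 n x \<Longrightarrow> multilinear P \<Longrightarrow> multilinear Q \<Longrightarrow> n \<le> m \<Longrightarrow>
    agree (act x (tens m P Q)) (tens (m - n) (act x P) Q)"
proof (induction arbitrary: P m rule: U.induct)
  case (U_base x)
  then obtain m' where m: "m = Suc m'" by (cases m) auto
  have "agree (act x (tens m P Q)) (tens m' (sh x P) Q)"
    using KD(2)[OF U_base(1) multilinear_tens[OF U_base(2,3)], of m] by (simp add: m loc_def sh_tens)
  moreover have "agree (act x P) (sh x P)"
    using KD(2)[OF U_base(1,2)] by (simp add: loc_def)
  ultimately show ?case using tens_cong[of "act x P" "sh x P"] by (simp add: m agree_def)
next
  case (U_step v n z)
  note v = KD(1)[OF U_step.hyps(1)] and z = U_L[OF U_step.hyps(2)]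
  obtain k where m: "m = Suc (n + k)" using U_step.prems(3) less_eq_Suc_le less_imp_Suc_add by metis
  have sh: "agree (act v P') (sh v P')" if "multilinear P'" for P'
    using KD(2)[OF U_step.hyps(1) that] by (simp add: loc_def)
  have "agree (act z (act v (tens m P Q))) (act z (tens (n + k) (sh v P) Q))"
    using sh[OF multilinear_tens[OF U_step.prems(1,2)], of m]
    by (intro act_cong[OF z]) (simp add: m sh_tens)
  moreover have "agree (act z (tens (n + k) (sh v P) Q)) (tens k (act z (sh v P)) Q)"
    using U_step.IH[OF multilinear_sh[OF U_step.prems(1) v] U_step.prems(2), of "n + k"] by simp
  moreover have "agree (act z (act v P)) (act z (sh v P))"
    using act_cong[OF z sh[OF U_step.prems(1)]] .
  ultimately have 1: "agree (act z (act v (tens m P Q))) (tens k (act z (act v P)) Q)"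
    using tens_cong[of "act z (act v P)" "act z (sh v P)"] by (simp add: agree_def)
  have mz: "multilinear (act z P)" using multilinear_act[OF z U_step.prems(1)] .
  have "agree (act z (tens m P Q)) (tens (Suc k) (act z P) Q)"
    using U_step.IH[OF U_step.prems(1,2), of m] by (simp add: m Suc_diff_le)
  then have "agree (act v (act z (tens m P Q))) (act v (tens (Suc k) (act z P) Q))"
    by (rule act_cong[OF v])
  moreover have "agree (act v (tens (Suc k) (act z P) Q)) (tens k (sh v (act z P)) Q)"
    using sh[OF multilinear_tens[OF mz U_step.prems(2)], of "Suc k"] by (simp add: sh_tens)
  ultimately have 2: "agree (act v (act z (tens m P Q))) (tens k (act v (act z P)) Q)"
    using tens_cong[OF sh[OF mz]] by (simp add: agree_def)
  have "tens k (act (bracket v z) P) Q ts = tens k (act z (act v P)) Q ts - tens k (act v (act z P)) Q ts"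
    if "ts \<in> lists L" for ts
    using tens_cong[of "act (bracket v z) P" "\<lambda>ts. act z (act v P) ts + (-1) * act v (act z P) ts"]
      tens_comb[of k "act z (act v P)" "-1" "act v (act z P)" Q ts] v z that
    by (simp add: agree_def act_bracket)
  then show ?case using 1 2 act_bracket[OF v z, of "tens m P Q"] by (simp add: agree_def m)
next
  case (U_add n x y)
  have "tens k (act (x + y) P) Q ts = tens k (act x P) Q ts + tens k (act y P) Q ts"
    if "ts \<in> lists L" for k ts
    using tens_cong[of "act (x + y) P" "\<lambda>ts. act x P ts + 1 * act y P ts"] U_add that
    by (simp add: agree_def act_add U_L tens_comb del: mult_1)
  then show ?case
    using U_add act_add[OF U_L[OF U_add.hyps(1)] U_L[OF U_add.hyps(2)], of "tens m P Q"]
    by (simp add: agree_def)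
next
  case (U_scale n x c)
  have "tens k (act (scale c x) P) Q ts = c * tens k (act x P) Q ts"
    if "ts \<in> lists L" for k ts
    using tens_cong[of "act (scale c x) P" "\<lambda>ts. (\<lambda>_. 0) ts + c * act x P ts"] U_scale that
    by (simp only: tens_comb tens_zero) (simp add: agree_def act_scale U_L)
  then show ?case
    using U_scale act_scale[OF U_L[OF U_scale.hyps(1)], of c "tens m P Q"] by (simp add: agree_def)
qed

end

section \<open>Absence of locally ad-nilpotent elements in positive degrees\<close>

locale local_module = local_action scale bracket L I act
  for scale :: "complex \<Rightarrow> 'a::ab_group_add \<Rightarrow> 'a" and bracket L I act +
  assumes act_ideal: "x \<in> I \<Longrightarrow> multilinear P \<Longrightarrow> ts \<in> lists L \<Longrightarrow> act x P ts = 0"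
begin

lemma not_ad_nilpotent_aux:
  assumes U: "U 1 M x" and P: "multilinear P" "agree (sh v P) (\<lambda>ts. 0)" "act x P [] \<noteq> 0"
    and v: "v \<in> K 1" and g: "slot_linear g" "g v = 1"
  shows "(bracket x ^^ n) v \<notin> I"
proof
  assume nI: "(bracket x ^^ n) v \<in> I"
  obtain M' where M: "M = Suc M'" using U_pos[OF U] by (cases M) auto
  define y where "y k = (bracket x ^^ k) v" for k
  \<comment> \<open>\<open>k\<close> copies of \<open>P\<close>, each reading \<open>M\<close>
    entries, the degree of \<open>x\<close>, followed by \<open>g\<close> on a single last
    entry.\<close>
  define Q where "Q k = (tens M P ^^ k) (\<lambda>ts. case ts of [t] \<Rightarrow> g t | _ \<Rightarrow> 0)" for k
  note x = U_L[OF U]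
  have y0: "y 0 = v" and ySuc: "y (Suc k) = bracket x (y k)" for k by (simp_all add: y_def)
  have Q0: "Q 0 = (\<lambda>ts. case ts of [t] \<Rightarrow> g t | _ \<Rightarrow> 0)" and QSuc: "Q (Suc k) = tens M P (Q k)" for k
    by (simp_all add: Q_def)
  have yL: "y k \<in> L" for k
    by (induction k) (simp_all add: y0 ySuc KD(1)[OF v] bracket_L x)
  have "multilinear (Q 0)"
  proof (rule multilinearI)
    fix ts assume "ts \<in> lists L"
    then show "slot_linear (\<lambda>t. Q 0 (t # ts))"
      using g(1) by (cases ts) (simp_all add: Q0 slot_linear_def)
  next
    fix t assume "t \<in> L"
    have "sh t (Q 0) = (\<lambda>ts. 0 + g t * unit_fun ts)"
      by (auto simp: Q0 sh_def unit_fun_def split: list.split)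
    then show "multilinear (sh t (Q 0))" using multilinear_comb[OF multilinear_0 multilinear_unit] by simp
  qed
  then have mQ: "multilinear (Q k)" for k
    by (induction k) (simp_all add: QSuc multilinear_tens P)
  have xQ: "agree (act x (Q (Suc k))) (\<lambda>ts. act x P [] * Q k ts)" for k
    using act_tens[OF U P(1) mQ, of M k] by (simp add: QSuc agree_def)
  have vQ: "agree (act v (Q (Suc k))) (\<lambda>ts. 0)" for k
  proof -
    have "tens M' (sh v P) (Q k) ts = 0" if "ts \<in> lists L" for ts
      using tens_cong[OF P(2) that] by (simp add: tens_zero)
    then show ?thesis
      using KD(2)[OF v mQ, of "Suc k"] by (simp add: agree_def loc_def QSuc M sh_tens)
  qed
  \<comment> \<open>Expand the commutator of \<open>x\<close> and \<open>y k\<close>: when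
    \<open>x\<close> is the leftmost factor, it is absorbed by the first copy of
    \<open>P\<close>.\<close>
  have step: "agree (act (y (Suc k)) (Q (Suc m)))
      (\<lambda>ts. act x P [] * act (y k) (Q m) ts - act x (act (y k) (Q (Suc m))) ts)" for k m
    using act_cong[OF yL[of k] xQ[of m]] x yL by (simp add: agree_def ySuc act_bracket act_scale_arg)
  \<comment> \<open>Every word in \<open>y k\<close> contains \<open>v\<close> after at most
    \<open>k\<close> factors \<open>x\<close>. With more than \<open>k\<close> copies of
    \<open>P\<close> available, \<open>v\<close> stands at the beginning of one of them and is
    killed.\<close>
  have zero: "agree (act (y k) (Q m)) (\<lambda>ts. 0)" if "k < m" for k m
    using that
  proof (induction k arbitrary: m)
    case 0
    then show ?case using vQ by (cases m) (auto simp: y0)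
  next
    case (Suc k)
    then obtain m' where m: "m = Suc m'" "k < m'" by (cases m) auto
    show ?case
      using step[of k m'] Suc.IH[of m'] act_cong[OF x Suc.IH[of m]] m x by (simp add: agree_def)
  qed
  have "act (y n) (Q n) [] = act x P [] ^ n"
  proof (induction n)
    case 0
    then show ?case using KD(2)[OF v mQ, of 0] g by (simp add: y0 agree_def loc_def sh_def Q0)
  next
    case (Suc n)
    then show ?case using step[of n n] act_cong[OF x zero[of n "Suc n"]] x by (simp add: agree_def)
  qed
  moreover have "act (y n) (Q n) [] = 0"
    using act_ideal[OF nI mQ, of "[]" n] by (simp add: y_def)
  ultimately show False using P(3) by simp
qed

lemma functional_mod_ideal:
  assumes "subspace S" "I \<subseteq> S" "x \<notin> S"
  obtains f where "slot_linear f" "\<And>y. y \<in> S \<Longrightarrow> f y = 0" "f x = 1"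
proof -
  obtain f where f: "Vector_Spaces.linear scale (*) f" "\<And>y. y \<in> S \<Longrightarrow> f y = 0" "f x = (1::complex)"
    using separating_functional[OF assms(1,3)] by blast
  interpret f: Vector_Spaces.linear scale "(*)" f by (rule f)
  have "slot_linear f"
    unfolding slot_linear_def
  proof (intro ballI allI impI)
    fix p q r c assume "p - (q + scale c r) \<in> I"
    then have "f (p - (q + scale c r)) = 0" using f assms by blast
    then show "f p = f q + c * f r" by (simp add: f.diff f.add f.scale)
  qed
  with f that show thesis by blast
qed

lemma subspace_I_plus: "subspace {y + scale c v | y c. y \<in> I}"
  unfolding subspace_def
proof (intro conjI ballI allI)
  show "0 \<in> {y + scale c v |y c. y \<in> I}" using I_closed(1) by (auto intro!: exI[of _ 0])
next
  fix a b assume "a \<in> {y + scale c v |y c. y \<in> I}" "b \<in> {y + scale c v |y c. y \<in> I}"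
  then obtain y c y' c' where "a = y + scale c v" "b = y' + scale c' v" "y \<in> I" "y' \<in> I" by blast
  then have "a + b = (y + y') + scale (c + c') v" "y + y' \<in> I"
    by (auto simp: scale_left_distrib I_closed)
  then show "a + b \<in> {y + scale c v |y c. y \<in> I}" by blast
next
  fix k a assume "a \<in> {y + scale c v |y c. y \<in> I}"
  then obtain y c where "a = y + scale c v" "y \<in> I" by blast
  then have "scale k a = scale k y + scale (k * c) v" "scale k y \<in> I"
    by (auto simp: scale_right_distrib I_closed)
  then show "scale k a \<in> {y + scale c v |y c. y \<in> I}" by blast
qed

text \<open>Two elements are essential, a free Lie algebra on one generator being abelian; which of
  them serves as witness depends on \<open>x\<close>. The two families in \<open>indep\<close>
  together express linear independence modulo \<open>I\<close>.\<close>

theorem not_ad_nilpotent: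
  assumes U: "U 1 M x" and xI: "x \<notin> I" and K: "v1 \<in> K 1" "v2 \<in> K 1"
    and indep: "\<And>c. v1 + scale c v2 \<notin> I" "\<And>c. v2 + scale c v1 \<notin> I"
  shows "\<exists>v\<in>{v1, v2}. \<forall>n. (bracket x ^^ n) v \<notin> I"
proof -
  have dual: "\<exists>g. slot_linear g \<and> g v = 1 \<and> g w = 0" if "\<And>c. v + scale c w \<notin> I" for v w
  proof -
    have v: "v \<notin> {y + scale c w | y c. y \<in> I}"
    proof
      assume "v \<in> {y + scale c w | y c. y \<in> I}"
      then obtain y c where "v = y + scale c w" "y \<in> I" by blast
      then have "v + scale (- c) w \<in> I" by simp
      with that show False by blast
    qed
    have "y = y + scale 0 w" "w = 0 + scale 1 w" for y by simp_all
    then have "I \<subseteq> {y + scale c w | y c. y \<in> I}" and w: "w \<in> {y + scale c w | y c. y \<in> I}"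
      using I_closed(1) by blast+
    then obtain g where "slot_linear g" "\<And>y. y \<in> {y + scale c w | y c. y \<in> I} \<Longrightarrow> g y = 0" "g v = 1"
      using functional_mod_ideal[OF subspace_I_plus _ v] by blast
    with w show ?thesis by blast
  qed
  obtain g1 where g1: "slot_linear g1" "g1 v1 = 1" "g1 v2 = 0" using dual[OF indep(1)] by blast
  obtain g2 where g2: "slot_linear g2" "g2 v2 = 1" "g2 v1 = 0" using dual[OF indep(2)] by blast
  obtain f where f: "slot_linear f" "f x = 1"
    using functional_mod_ideal[OF subspace_I _ xI] by blast
  note x = U_L[OF U] and v1 = KD(1)[OF K(1)]
  define P where "P = dynkin f"
  \<comment> \<open>Split \<open>P = P1 + P2\<close> with \<open>P1\<close> vanishing on \<open>v1 \<otimes> \<dots>\<close> and \<open>P2\<close> on \<open>v2 \<otimes> \<dots>\<close>.\<close>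
  define P2 where "P2 ts = (case ts of [] \<Rightarrow> 0 | t # s \<Rightarrow> g1 t * P (v1 # s))" for ts
  define P1 where "P1 ts = P ts + (-1) * P2 ts" for ts
  have mP: "multilinear P" unfolding P_def by (rule multilinear_dynkin[OF f(1)])
  have sh2: "sh t P2 = (\<lambda>ts. 0 + g1 t * sh v1 P ts)" for t by (simp add: sh_def P2_def)
  have mP2: "multilinear P2"
  proof (rule multilinearI)
    fix ts assume "ts \<in> lists L"
    show "slot_linear (\<lambda>t. P2 (t # ts))" using g1(1) by (auto simp: P2_def slot_linear_def algebra_simps)
  next
    fix t assume "t \<in> L"
    show "multilinear (sh t P2)" unfolding sh2 by (intro multilinear_comb multilinear_0 multilinear_sh mP v1)
  qed
  have mP1: "multilinear P1" unfolding P1_def using multilinear_comb[OF mP mP2] .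
  have "act x P [] = of_nat M" using act_dynkin[OF U f(1)] f(2) by (simp add: agree_def P_def)
  then have "act x P [] \<noteq> 0" using U_pos[OF U] by simp
  moreover have "act x P1 [] = act x P [] + (-1) * act x P2 []"
    unfolding P1_def by (rule act_comb[OF x])
  ultimately consider "act x P1 [] \<noteq> 0" | "act x P2 [] \<noteq> 0" by force
  then show ?thesis
  proof cases
    case 1
    have "agree (sh v1 P1) (\<lambda>ts. 0)" by (simp add: agree_def sh_def P1_def P2_def g1)
    then show ?thesis using not_ad_nilpotent_aux[OF U mP1 _ 1 K(1) g1(1,2)] by blast
  next
    case 2
    have "agree (sh v2 P2) (\<lambda>ts. 0)" by (simp add: agree_def sh2 g1)
    then show ?thesis using not_ad_nilpotent_aux[OF U mP2 _ 2 K(2) g2(1,2)] by blast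
  qed
qed

end

section \<open>Linear extension of functions on words\<close>

definition evl :: "elt \<Rightarrow> (gen list \<Rightarrow> complex) \<Rightarrow> complex" where
  "evl p c = (\<Sum>w | p w \<noteq> 0. p w * c w)"

text \<open>The type \<open>elt\<close> also contains formal series. For them the sum in
  \<open>evl\<close> defaults to 0, so linearity of \<open>evl\<close> requires finite
  support.\<close>

definition fin_supp :: "elt \<Rightarrow> bool" where
  "fin_supp p \<longleftrightarrow> finite {w. p w \<noteq> 0}"

lemma evl_superset: "finite A \<Longrightarrow> {w. p w \<noteq> 0} \<subseteq> A \<Longrightarrow> evl p c = (\<Sum>w\<in>A. p w * c w)"
  unfolding evl_def by (rule sum.mono_neutral_left) auto

lemma fin_supp_add: "fin_supp p \<Longrightarrow> fin_supp q \<Longrightarrow> fin_supp (p + q)"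
  unfolding fin_supp_def
  by (rule finite_subset[of _ "{w. p w \<noteq> 0} \<union> {w. q w \<noteq> 0}"]) auto

lemma fin_supp_smult: "fin_supp p \<Longrightarrow> fin_supp (psmult c p)"
  unfolding fin_supp_def by (rule finite_subset[of _ "{w. p w \<noteq> 0}"]) (auto simp: psmult_def)

lemma fin_supp_diff: "fin_supp p \<Longrightarrow> fin_supp q \<Longrightarrow> fin_supp (p - q)"
  unfolding fin_supp_def
  by (rule finite_subset[of _ "{w. p w \<noteq> 0} \<union> {w. q w \<noteq> 0}"]) auto

lemma evl_add:
  assumes "fin_supp p" "fin_supp q"
  shows "evl (p + q) c = evl p c + evl q c"
proof -
  let ?A = "{w. p w \<noteq> 0} \<union> {w. q w \<noteq> 0}"
  have A: "finite ?A" using assms by (simp add: fin_supp_def)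
  have "evl (p + q) c = (\<Sum>w\<in>?A. (p + q) w * c w)" using A by (intro evl_superset) auto
  moreover have "evl p c = (\<Sum>w\<in>?A. p w * c w)" using A by (intro evl_superset) auto
  moreover have "evl q c = (\<Sum>w\<in>?A. q w * c w)" using A by (intro evl_superset) auto
  ultimately show ?thesis by (simp add: distrib_right sum.distrib)
qed

lemma evl_smult:
  assumes "fin_supp p"
  shows "evl (psmult k p) c = k * evl p c"
proof -
  have "evl (psmult k p) c = (\<Sum>w | p w \<noteq> 0. psmult k p w * c w)"
    using assms by (intro evl_superset) (auto simp: psmult_def fin_supp_def)
  then show ?thesis by (simp add: evl_def psmult_def sum_distrib_left mult.assoc)
qed

lemma evl_diff: "fin_supp p \<Longrightarrow> fin_supp q \<Longrightarrow> evl (p - q) c = evl p c - evl q c"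
  using evl_add[of "p - q" q c] fin_supp_diff[of p q] by simp

lemma evl_gel [simp]: "evl (gel g) c = c [g]"
  using evl_superset[of "{[g]}" "gel g" c] by (auto simp: gel_def)

text \<open>Indexing by pairs of support words instead of cut positions makes
  \<open>evl_pmul\<close> a regrouping of one finite double sum along concatenation.\<close>

lemma pmul_conv_sum:
  assumes "fin_supp p" "fin_supp q"
  shows "pmul p q w = (\<Sum>(u, v) \<in> {x \<in> {u. p u \<noteq> 0} \<times> {v. q v \<noteq> 0}. fst x @ snd x = w}. p u * q v)"
proof -
  let ?split = "\<lambda>k. (take k w, drop k w)"
  have inj: "inj_on ?split {..length w}"
    by (rule inj_onI) (metis Pair_inject atMost_iff length_take min.absorb2)
  have img: "?split ` {..length w} = {(u, v). u @ v = w}"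
  proof (intro equalityI subsetI)
    fix x assume "x \<in> {(u, v). u @ v = w}"
    then have "x = ?split (length (fst x))" "length (fst x) \<le> length w" by auto
    then show "x \<in> ?split ` {..length w}" by (intro image_eqI) auto
  qed auto
  have "pmul p q w = (\<Sum>(u, v) \<in> ?split ` {..length w}. p u * q v)"
    using sum.reindex[OF inj, of "\<lambda>(u, v). p u * q v"] by (simp add: pmul_def)
  also have "\<dots> = (\<Sum>(u, v) \<in> {x \<in> {u. p u \<noteq> 0} \<times> {v. q v \<noteq> 0}. fst x @ snd x = w}. p u * q v)"
  proof (rule sum.mono_neutral_right)
    show "{x \<in> {u. p u \<noteq> 0} \<times> {v. q v \<noteq> 0}. fst x @ snd x = w} \<subseteq> ?split ` {..length w}"
      unfolding img by auto
    show "finite (?split ` {..length w})" by simp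
  qed (unfold img, auto)
  finally show ?thesis .
qed

lemma pmul_supp:
  assumes "fin_supp p" "fin_supp q"
  shows "{w. pmul p q w \<noteq> 0} \<subseteq> (\<lambda>x. fst x @ snd x) ` ({u. p u \<noteq> 0} \<times> {v. q v \<noteq> 0})"
proof
  fix w assume "w \<in> {w. pmul p q w \<noteq> 0}"
  then have "(\<Sum>(u, v) \<in> {x \<in> {u. p u \<noteq> 0} \<times> {v. q v \<noteq> 0}. fst x @ snd x = w}. p u * q v) \<noteq> 0"
    using pmul_conv_sum[OF assms, of w] by simp
  then obtain x where "x \<in> {u. p u \<noteq> 0} \<times> {v. q v \<noteq> 0}" "fst x @ snd x = w"
    by (rule sum.not_neutral_contains_not_neutral) blast
  then show "w \<in> (\<lambda>x. fst x @ snd x) ` ({u. p u \<noteq> 0} \<times> {v. q v \<noteq> 0})" by blast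
qed

lemma fin_supp_pmul: "fin_supp p \<Longrightarrow> fin_supp q \<Longrightarrow> fin_supp (pmul p q)"
  using pmul_supp[of p q] finite_subset by (fastforce simp: fin_supp_def)

lemma fin_supp_br: "fin_supp p \<Longrightarrow> fin_supp q \<Longrightarrow> fin_supp (br p q)"
  by (simp add: br_eq fin_supp_diff fin_supp_pmul)

lemma evl_pmul:
  assumes "fin_supp p" "fin_supp q"
  shows "evl (pmul p q) c = evl p (\<lambda>u. evl q (\<lambda>v. c (u @ v)))"
proof -
  let ?S = "{u. p u \<noteq> 0} \<times> {v. q v \<noteq> 0}" and ?j = "\<lambda>x. fst x @ snd x"
  have S: "finite ?S" using assms by (simp add: fin_supp_def)
  have "evl (pmul p q) c = (\<Sum>w \<in> ?j ` ?S. pmul p q w * c w)"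
    using S pmul_supp[OF assms] by (intro evl_superset) auto
  also have "\<dots> = (\<Sum>w \<in> ?j ` ?S. \<Sum>x \<in> {x \<in> ?S. ?j x = w}. p (fst x) * q (snd x) * c (?j x))"
    unfolding pmul_conv_sum[OF assms] sum_distrib_right by (intro sum.cong) (auto simp: case_prod_beta)
  also have "\<dots> = (\<Sum>x \<in> ?S. p (fst x) * q (snd x) * c (?j x))"
    using sum.image_gen[OF S, of "\<lambda>x. p (fst x) * q (snd x) * c (?j x)" ?j] by simp
  also have "\<dots> = (\<Sum>u | p u \<noteq> 0. \<Sum>v | q v \<noteq> 0. p u * q v * c (u @ v))"
    by (simp add: sum.cartesian_product case_prod_beta)
  also have "\<dots> = evl p (\<lambda>u. evl q (\<lambda>v. c (u @ v)))"
    by (simp add: evl_def sum_distrib_left mult.assoc)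
  finally show ?thesis .
qed

lemma lie_ideal_subset:
  assumes "x \<in> lie_ideal (lie_gen S) R" "R \<subseteq> lie_gen S"
  shows "x \<in> lie_gen S"
  using assms(1) by induction (use assms(2) in \<open>auto intro: lie_gen.intros\<close>)

lemma lie_pair_presentation:
  assumes "R \<subseteq> lie_gen S"
  shows "lie_pair psmult br (lie_gen S) (lie_ideal (lie_gen S) R)"
  using lie_ideal_subset[OF _ assms]
  by unfold_locales (auto simp: subspace_lie_gen subspace_lie_ideal intro: lie_gen.brk lie_ideal.brk)

lemma fin_supp_gel: "fin_supp (gel g)"
  by (simp add: fin_supp_def gel_def)

lemma fin_supp_lie_gen:
  assumes "x \<in> lie_gen (gel ` X)"
  shows "fin_supp x"
proof -
  have "elt.subspace {x. fin_supp x}"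
    using fin_supp_add fin_supp_smult by (auto simp: elt.subspace_def) (simp add: fin_supp_def)
  then have "x \<in> {x. fin_supp x}"
    by (rule lie_gen_least[OF assms, rotated]) (auto simp: fin_supp_gel fin_supp_br)
  then show ?thesis by simp
qed

section \<open>Graded presentations\<close>

locale letter_grading =
  fixes dg :: "gen \<Rightarrow> int"
begin

definition deg :: "gen list \<Rightarrow> int" where
  "deg w = sum_list (map dg w)"

definition homog :: "int \<Rightarrow> elt \<Rightarrow> bool" where
  "homog m x \<longleftrightarrow> (\<forall>w. x w \<noteq> 0 \<longrightarrow> deg w = m)"

definition proj :: "int \<Rightarrow> elt \<Rightarrow> elt" where
  "proj m x = (\<lambda>w. if deg w = m then x w else 0)"

lemma deg_append: "deg (u @ v) = deg u + deg v"
  by (simp add: deg_def)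

lemma homog_gel: "homog (dg g) (gel g)"
  by (simp add: homog_def gel_def deg_def)

lemma homog_proj: "homog m (proj m x)"
  by (simp add: homog_def proj_def)

lemma proj_homog: "homog m x \<Longrightarrow> proj m' x = (if m' = m then x else 0)"
  by (auto simp: homog_def proj_def fun_eq_iff)

lemma proj_add: "proj m (x + y) = proj m x + proj m y"
  by (auto simp: proj_def fun_eq_iff)

lemma proj_diff: "proj m (x - y) = proj m x - proj m y"
  by (auto simp: proj_def fun_eq_iff)

lemma proj_smult: "proj m (psmult c x) = psmult c (proj m x)"
  by (auto simp: proj_def psmult_def fun_eq_iff)

lemma proj_0: "proj m 0 = 0"
  by (auto simp: proj_def fun_eq_iff)

lemma proj_pmul_homog_left: "homog j g \<Longrightarrow> proj (m + j) (pmul g x) = pmul g (proj m x)"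
proof
  fix w assume g: "homog j g"
  have "deg w = deg (take k w) + deg (drop k w)" for k
    using deg_append[of "take k w" "drop k w"] by simp
  with g show "proj (m + j) (pmul g x) w = pmul g (proj m x) w"
    unfolding proj_def pmul_def homog_def
    by (auto intro!: sum.cong sum.neutral) (metis add.commute add_left_cancel)+
qed

lemma proj_pmul_homog_right: "homog j g \<Longrightarrow> proj (m + j) (pmul x g) = pmul (proj m x) g"
proof
  fix w assume g: "homog j g"
  have "deg w = deg (take k w) + deg (drop k w)" for k
    using deg_append[of "take k w" "drop k w"] by simp
  with g show "proj (m + j) (pmul x g) w = pmul (proj m x) g w"
    unfolding proj_def pmul_def homog_def
    by (auto intro!: sum.cong sum.neutral) (metis add.commute add_left_cancel)+
qed

lemma proj_br: "homog j g \<Longrightarrow> proj (m + j) (br g x) = br g (proj m x)"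
  by (simp add: br_eq proj_diff proj_pmul_homog_left proj_pmul_homog_right)

lemma homog_br: "homog j x \<Longrightarrow> homog k y \<Longrightarrow> homog (j + k) (br x y)"
  using proj_br[of j x k y] homog_proj[of "k + j" "br x y"] by (simp add: proj_homog add.commute)

lemma sum_apply: "(\<Sum>m\<in>A. f m) w = (\<Sum>m\<in>A. f m w)" for f :: "'b \<Rightarrow> elt"
  by (induction A rule: infinite_finite_induct) auto

lemma sum_proj: "finite A \<Longrightarrow> {m. proj m x \<noteq> 0} \<subseteq> A \<Longrightarrow> x = (\<Sum>m\<in>A. proj m x)"
proof
  fix w assume A: "finite A" "{m. proj m x \<noteq> 0} \<subseteq> A"
  have "x w = (\<Sum>m\<in>A. if deg w = m then x w else 0)"
  proof (cases "x w = 0")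
    case False
    then have "proj (deg w) x \<noteq> 0" by (auto simp: proj_def fun_eq_iff)
    then show ?thesis using A by auto
  qed (simp add: sum.neutral)
  then show "x w = (\<Sum>m\<in>A. proj m x) w" unfolding sum_apply proj_def by simp
qed

lemma proj_sum: "proj m (\<Sum>j\<in>A. f j) = (\<Sum>j\<in>A. proj m (f j))"
  by (rule ext) (simp add: proj_def sum_apply)

lemma proj_bracket:
  assumes "finite A" "{m. proj m x \<noteq> 0} \<subseteq> A"
  shows "proj m (br x z) = (\<Sum>j\<in>A. br (proj j x) (proj (m - j) z))"
proof -
  have "proj m (br x z) = (\<Sum>j\<in>A. proj m (br (proj j x) z))"
    by (subst sum_proj[OF assms]) (simp only: elt.bracket_sum_left proj_sum)
  also have "\<dots> = (\<Sum>j\<in>A. br (proj j x) (proj (m - j) z))"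
  proof (rule sum.cong)
    fix j show "proj m (br (proj j x) z) = br (proj j x) (proj (m - j) z)"
      using proj_br[OF homog_proj, of "m - j" j x z] by simp
  qed simp
  finally show ?thesis .
qed

end

locale graded_presentation = letter_grading dg for dg :: "gen \<Rightarrow> int" +
  fixes X :: "gen set" and R :: "elt set"
  assumes R_subset: "R \<subseteq> lie_gen (gel ` X)" and dg_range: "dg g \<in> {-1,0,1}"
    and R_homogeneous: "r \<in> R \<Longrightarrow> \<exists>m. homog m r"
begin

abbreviation L where "L \<equiv> lie_gen (gel ` X)"
abbreviation I where "I \<equiv> lie_ideal L R"

sublocale lie_pair psmult br L I
  using lie_pair_presentation[OF R_subset] .

text \<open>Each letter acts by the local operator of its own degree. Letters outside
  \<open>X\<close> act as 0, a default that keeps the action on words total.\<close>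

definition opg :: "gen \<Rightarrow> (elt list \<Rightarrow> complex) \<Rightarrow> elt list \<Rightarrow> complex" where
  "opg g P = (if g \<in> X then loc (dg g) (gel g) P else (\<lambda>ts. 0))"

fun opw :: "gen list \<Rightarrow> (elt list \<Rightarrow> complex) \<Rightarrow> elt list \<Rightarrow> complex" where
  "opw [] P = P"
| "opw (g # w) P = opw w (opg g P)"

text \<open>Since \<^const>\<open>opw\<close> transposes an action, it applies the first letter of a word first.\<close>

definition act :: "elt \<Rightarrow> (elt list \<Rightarrow> complex) \<Rightarrow> elt list \<Rightarrow> complex" where
  "act x P ts = evl x (\<lambda>w. opw w P ts)"

lemma gel_L: "g \<in> X \<Longrightarrow> gel g \<in> L"
  by (auto intro: lie_gen.base)

lemma opg_sum: "opg g (\<lambda>ts. \<Sum>u\<in>A. c u * Q u ts) = (\<lambda>ts. \<Sum>u\<in>A. c u * opg g (Q u) ts)"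
  by (auto simp: opg_def loc_sum)

lemma opw_sum: "opw w (\<lambda>ts. \<Sum>u\<in>A. c u * Q u ts) ts = (\<Sum>u\<in>A. c u * opw w (Q u) ts)"
  by (induction w arbitrary: Q) (simp_all add: opg_sum)

lemma opg_comb: "opg g (\<lambda>ts. P ts + c * Q ts) = (\<lambda>ts. opg g P ts + c * opg g Q ts)"
  by (auto simp: opg_def loc_comb)

lemma opw_comb: "opw w (\<lambda>ts. P ts + c * Q ts) ts = opw w P ts + c * opw w Q ts"
  by (induction w arbitrary: P Q) (simp_all add: opg_comb)

lemma opw_append: "opw (u @ v) P = opw v (opw u P)"
  by (induction u arbitrary: P) simp_all

lemma opw_cong: "agree P Q \<Longrightarrow> agree (opw w P) (opw w Q)"
proof (induction w arbitrary: P Q)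
  case (Cons g w)
  have "agree (opg g P) (opg g Q)" using loc_cong[OF Cons.prems gel_L] by (simp add: opg_def agree_refl)
  then show ?case using Cons.IH by simp
qed simp

lemma multilinear_opw: "multilinear P \<Longrightarrow> multilinear (opw w P)"
proof (induction w arbitrary: P)
  case (Cons g w)
  have "multilinear (opg g P)" using multilinear_loc[OF gel_L Cons.prems] by (simp add: opg_def multilinear_0)
  then show ?case using Cons.IH by simp
qed simp

lemma multilinear_sum: "(\<And>u. u \<in> A \<Longrightarrow> multilinear (Q u)) \<Longrightarrow> multilinear (\<lambda>ts. \<Sum>u\<in>A. c u * Q u ts)"
proof (induction A rule: infinite_finite_induct)
  case (insert x A)
  then show ?case
    using multilinear_comb[of "\<lambda>ts. \<Sum>u\<in>A. c u * Q u ts" "Q x" "c x"] by (simp add: add.commute)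
qed (simp_all add: multilinear_0)

lemma act_pmul: "fin_supp x \<Longrightarrow> fin_supp y \<Longrightarrow> act (pmul x y) P ts = act y (act x P) ts"
  unfolding act_def evl_pmul opw_append unfolding evl_def opw_sum sum_distrib_left
  by (subst sum.swap) (simp add: algebra_simps)

sublocale local_action psmult br L I act
proof
  fix x y :: elt and P Q ts and c :: complex
  assume "x \<in> L"
  then have x: "fin_supp x" by (rule fin_supp_lie_gen)
  show "act (psmult c x) P ts = c * act x P ts"
    using x by (simp add: act_def evl_smult)
  show "act x (\<lambda>ts. P ts + c * Q ts) ts = act x P ts + c * act x Q ts"
    by (simp add: act_def evl_def opw_comb distrib_left sum.distrib sum_distrib_left mult.left_commute)
  show "agree P Q \<Longrightarrow> agree (act x P) (act x Q)"
    using opw_cong[of P Q] by (simp add: agree_def act_def evl_def)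
  show "multilinear P \<Longrightarrow> multilinear (act x P)"
    using multilinear_sum[of "{w. x w \<noteq> 0}" "\<lambda>w. opw w P" x] multilinear_opw[of P]
    by (simp add: act_def[abs_def] evl_def)
  assume "y \<in> L"
  then have y: "fin_supp y" by (rule fin_supp_lie_gen)
  show "act (x + y) P ts = act x P ts + act y P ts"
    using x y by (simp add: act_def evl_add)
  have "act (br x y) P ts = act (pmul x y) P ts - act (pmul y x) P ts"
    using x y by (simp add: br_eq act_def evl_diff fin_supp_pmul)
  then show "act (br x y) P ts = act y (act x P) ts - act x (act y P) ts"
    using x y by (simp add: act_pmul)
qed

lemma gel_K: "g \<in> X \<Longrightarrow> gel g \<in> K (dg g)"
  by (auto simp: K_def gel_L act_def opg_def agree_def)

lemma proj_stable:
  assumes T: "elt.subspace T" and st: "\<And>g z. g \<in> X \<Longrightarrow> z \<in> T \<Longrightarrow> br (gel g) z \<in> T"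
  shows "g \<in> X \<Longrightarrow> (\<forall>m. proj m z \<in> T) \<Longrightarrow> (\<forall>m. proj m (br (gel g) z) \<in> T)"
proof
  fix m assume "g \<in> X" "\<forall>m. proj m z \<in> T"
  then show "proj m (br (gel g) z) \<in> T"
    using proj_br[OF homog_gel, of "m - dg g" g z] st by simp
qed

lemma proj_L: "x \<in> L \<Longrightarrow> proj m x \<in> L"
proof -
  assume "x \<in> L"
  have "x \<in> {x. \<forall>m. proj m x \<in> L}"
  proof (rule lie_gen_induct_ad[OF \<open>x \<in> L\<close>])
    show "gel ` X \<subseteq> {x. \<forall>m. proj m x \<in> L}" using gel_L L_closed(1) by (auto simp: proj_homog[OF homog_gel])
    show "elt.subspace {x. \<forall>m. proj m x \<in> L}"
      using L_closed by (auto simp: elt.subspace_def proj_add proj_smult proj_0)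
    fix s z assume "s \<in> gel ` X" "z \<in> {x. \<forall>m. proj m x \<in> L}"
    then show "br s z \<in> {x. \<forall>m. proj m x \<in> L}"
      using proj_stable[OF subspace_L bracket_L[OF gel_L]] by blast
  qed
  then show ?thesis by blast
qed

lemma proj_I: "x \<in> I \<Longrightarrow> proj m x \<in> I"
proof -
  assume "x \<in> I"
  let ?T = "{x. \<forall>m. proj m x \<in> I}"
  have T: "elt.subspace ?T"
    using I_closed by (auto simp: elt.subspace_def proj_add proj_smult proj_0)
  have st: "br s z \<in> ?T" if "s \<in> gel ` X" "z \<in> ?T" for s z
    using proj_stable[OF subspace_I bracket_I[OF gel_L]] that by blast
  have "x \<in> ?T" using \<open>x \<in> I\<close>
  proof induction
    case (base r)
    then obtain m where "homog m r" using R_homogeneous[of r] by blast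
    then show "r \<in> ?T" using base lie_ideal.base I_closed(1) by (auto simp: proj_homog)
  next
    case zero show "pzero \<in> ?T" using elt.subspace_0[OF T] by (simp only: pzero_eq)
  next
    case (add x y) then show "padd x y \<in> ?T" using elt.subspace_add[OF T] by (simp only: padd_eq)
  next
    case (smult x c) then show "psmult c x \<in> ?T" using elt.subspace_scale[OF T] by blast
  next
    case (brk y x) then show "br y x \<in> ?T" using lie_gen_stable[OF st T] by blast
  qed
  then show ?thesis by blast
qed

text \<open>Generators have degrees -1, 0, 1 and lie in the corresponding \<open>K\<close>, so
  \<open>W_bracket\<close> applies to each bracket with a generator. In particular components of
  positive degree are spanned by nested brackets of elements of \<open>K 1\<close>.\<close>

lemma proj_W: "x \<in> L \<Longrightarrow> proj m x \<in> W m"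
proof -
  assume "x \<in> L"
  have W0: "0 \<in> W m" for m using elt.subspace_0[OF subspace_W] .
  have "x \<in> {x. \<forall>m. proj m x \<in> W m}"
  proof (rule lie_gen_induct_ad[OF \<open>x \<in> L\<close>])
    show "gel ` X \<subseteq> {x. \<forall>m. proj m x \<in> W m}"
    proof clarify
      fix g m assume g: "g \<in> X"
      have "gel g \<in> W (dg g)"
        using gel_K[OF g] dg_range[of g] U_base[of "gel g"] by (auto simp: W_def)
      then show "proj m (gel g) \<in> W m" using W0 by (simp add: proj_homog[OF homog_gel])
    qed
    show "elt.subspace {x. \<forall>m. proj m x \<in> W m}"
      using subspace_W W0 by (auto simp: elt.subspace_def proj_add proj_smult proj_0)
    fix s z assume "s \<in> gel ` X" and z: "z \<in> {x. \<forall>m. proj m x \<in> W m}"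
    then obtain g where g: "g \<in> X" "s = gel g" by blast
    have "proj m (br s z) \<in> W m" for m
      using W_bracket[OF gel_K[OF g(1)] dg_range, of "proj (m - dg g) z" "m - dg g"] z
        proj_br[OF homog_gel, of "m - dg g" g z] g(2) by simp
    then show "br s z \<in> {x. \<forall>m. proj m x \<in> W m}" by blast
  qed
  then show ?thesis by blast
qed

lemma finite_degrees: "x \<in> L \<Longrightarrow> finite {m. proj m x \<noteq> 0}"
proof -
  assume "x \<in> L"
  then have "finite (deg ` {w. x w \<noteq> 0})" using fin_supp_lie_gen by (simp add: fin_supp_def)
  then show ?thesis by (rule rev_finite_subset) (auto simp: proj_def fun_eq_iff split: if_splits)
qed

lemma sum_I: "(\<And>j. j \<in> A \<Longrightarrow> f j \<in> I) \<Longrightarrow> sum f A \<in> I"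
  by (rule elt.subspace_sum[OF subspace_I])

lemma funpow_br_L: "x \<in> L \<Longrightarrow> y \<in> L \<Longrightarrow> (br x ^^ n) y \<in> L"
  by (induction n) (auto simp del: One_nat_def intro: bracket_L)

text \<open>Modulo \<open>I\<close>, the leading term of a power of \<open>ad x\<close> is the power
  of the leading term. Vanishing above the top degree is proved simultaneously, as it disposes of
  the mixed terms.\<close>

lemma top_component_power:
  assumes x: "x \<in> L" and y: "y \<in> L" "homog k y" and N: "\<And>m. m > N \<Longrightarrow> proj m x \<in> I"
  shows "(\<forall>m > k + int n * N. proj m ((br x ^^ n) y) \<in> I) \<and>
    proj (k + int n * N) ((br x ^^ n) y) - (br (proj N x) ^^ n) y \<in> I"
proof (induction n)
  case 0
  show "(\<forall>m > k + int 0 * N. proj m ((br x ^^ 0) y) \<in> I) \<and>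
      proj (k + int 0 * N) ((br x ^^ 0) y) - (br (proj N x) ^^ 0) y \<in> I"
    using I_closed(1) by (simp add: proj_homog[OF y(2)])
next
  case (Suc n)
  define z where "z = (br x ^^ n) y"
  define z' where "z' = (br (proj N x) ^^ n) y"
  have z: "z \<in> L" "z' \<in> L" using funpow_br_L x y proj_L by (auto simp: z_def z'_def)
  define A where "A = insert N {m. proj m x \<noteq> 0}"
  have A: "finite A" "{m. proj m x \<noteq> 0} \<subseteq> A" using finite_degrees[OF x] by (auto simp: A_def)
  have IH: "proj m z \<in> I" if "m > k + int n * N" for m using Suc that by (simp add: z_def)
  have IH': "proj (k + int n * N) z - z' \<in> I"
    unfolding z_def z'_def by (rule conjunct2[OF Suc.IH])
  \<comment> \<open>If the degrees of the two factors add up to at least the sum of the two bounds,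
    then one factor exceeds its bound unless both attain it.\<close>
  have high: "br (proj j x) (proj m z) \<in> I" if "j > N \<or> m > k + int n * N" for j m
    using that N IH z x proj_L by (auto intro: bracket_I bracket_I_left)
  have "proj m (br x z) \<in> I" if "m > k + int (Suc n) * N" for m
    unfolding proj_bracket[OF A]
  proof (rule sum_I, rule high)
    fix j show "j > N \<or> m - j > k + int n * N" using that by (auto simp: algebra_simps)
  qed
  moreover have "proj (k + int (Suc n) * N) (br x z) - br (proj N x) z' \<in> I"
  proof -
    let ?m = "k + int (Suc n) * N"
    have "proj ?m (br x z) = br (proj N x) (proj (?m - N) z)
        + (\<Sum>j\<in>A - {N}. br (proj j x) (proj (?m - j) z))"
      unfolding proj_bracket[OF A] using A by (intro sum.remove) (auto simp: A_def)
    moreover have "(\<Sum>j\<in>A - {N}. br (proj j x) (proj (?m - j) z)) \<in> I"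
    proof (rule sum_I, rule high)
      fix j assume "j \<in> A - {N}"
      then show "j > N \<or> ?m - j > k + int n * N" by (auto simp: algebra_simps)
    qed
    moreover have "br (proj N x) (proj (?m - N) z) - br (proj N x) z' \<in> I"
      using bracket_I[OF proj_L[OF x] IH'] by (simp add: elt.bracket_diff_right algebra_simps)
    ultimately show ?thesis
      using I_closed(2)[of "br (proj N x) (proj (?m - N) z) - br (proj N x) z'"
          "\<Sum>j\<in>A - {N}. br (proj j x) (proj (?m - j) z)"]
      by (simp only: add_diff_eq diff_add_eq)
  qed
  ultimately show "(\<forall>m > k + int (Suc n) * N. proj m ((br x ^^ Suc n) y) \<in> I) \<and>
      proj (k + int (Suc n) * N) ((br x ^^ Suc n) y) - (br (proj N x) ^^ Suc n) y \<in> I"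
    by (simp add: z_def z'_def)
qed

text \<open>Positive degree can be entered from degree 0 only by bracketing with a generator of
  degree one, and such a generator lies in \<open>I\<close>.\<close>

lemma positive_part_trivial:
  assumes "\<And>g. g \<in> X \<Longrightarrow> dg g = 1 \<Longrightarrow> gel g \<in> I" and "x \<in> L" and "m > 0"
  shows "proj m x \<in> I"
proof -
  let ?T = "{x \<in> L. \<forall>m > 0. proj m x \<in> I}"
  have "x \<in> ?T"
  proof (rule lie_gen_induct_ad[OF assms(2)])
    have "gel g \<in> I" if "g \<in> X" "dg g > 0" for g
      using assms(1)[OF that(1)] dg_range[of g] that(2) by auto
    then show "gel ` X \<subseteq> ?T" using I_closed(1) by (auto simp: gel_L proj_homog[OF homog_gel])
    show "elt.subspace ?T"
      using I_closed L_closed by (auto simp: elt.subspace_def proj_add proj_smult proj_0)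
    fix s z assume "s \<in> gel ` X" and z: "z \<in> ?T"
    then obtain g where g: "g \<in> X" "s = gel g" by blast
    have "proj m (br s z) \<in> I" if "m > 0" for m
    proof -
      have "br (gel g) (proj (m - dg g) z) \<in> I"
      proof (cases "dg g = 1")
        case True
        then show ?thesis using bracket_I_left assms(1) g z proj_L by auto
      next
        case False
        then have "m - dg g > 0" using that dg_range[of g] by auto
        then show ?thesis using bracket_I[OF gel_L[OF g(1)]] z by auto
      qed
      then show ?thesis using proj_br[OF homog_gel, of "m - dg g" g z] g(2) by simp
    qed
    then show "br s z \<in> ?T" using z g bracket_L[OF gel_L[OF g(1)]] by blast
  qed
  then show ?thesis using assms(3) by blast
qed

end

locale local_presentation = graded_presentation +
  assumes R_K: "r \<in> R \<Longrightarrow> \<exists>m. r \<in> K m"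
begin

sublocale local_module psmult br L I act
proof
  fix x P ts assume "x \<in> I" "multilinear P" "ts \<in> lists L"
  then show "act x P ts = 0"
  proof (induction arbitrary: P ts)
    case (base r)
    \<comment> \<open>\<open>r\<close> acts as \<open>loc m r\<close>; this is slot-linear in
      \<open>r\<close>, and therefore 0 for \<open>r\<close> in \<open>I\<close>.\<close>
    then obtain m where r: "r \<in> K m" using R_K by blast
    then show ?case
      using KD(2)[OF r base(2)] slot_linear_zero[OF loc_slot[OF base(2,3)] lie_ideal.base[OF base(1)]] base(3)
      by (simp add: agree_def)
  next
    case zero
    show "act pzero P ts = 0" by (simp add: act_def evl_def pzero_def)
  next
    case (add x y)
    then have "x \<in> L" "y \<in> L" using I_subset by auto
    then show "act (padd x y) P ts = 0"
      using act_add add.IH[OF add.prems] by (simp add: padd_eq)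
  next
    case (smult x c)
    then have "x \<in> L" using I_subset by auto
    then show "act (psmult c x) P ts = 0" using act_scale smult.IH[OF smult.prems] by simp
  next
    case (brk y x)
    have x: "x \<in> L" using brk.hyps I_subset by blast
    have "agree (act x P) (\<lambda>ts. 0)" using brk.IH[OF brk.prems(1)] by (simp add: agree_def)
    then have "agree (act y (act x P)) (act y (\<lambda>ts. 0))" by (rule act_cong[OF brk.hyps(1)])
    then have "act y (act x P) ts = 0"
      using act_0[OF brk.hyps(1), of ts] brk.prems(2) unfolding agree_def by metis
    moreover have "act x (act y P) ts = 0"
      using brk.IH[OF multilinear_act[OF brk.hyps(1) brk.prems(1)] brk.prems(2)] .
    ultimately show "act (br y x) P ts = 0" using act_bracket[OF brk.hyps(1) x] by simp
  qed
qed

theorem positive_part_nilpotent: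
  assumes x: "x \<in> L" and nil: "\<And>y. y \<in> L \<Longrightarrow> \<exists>n. (br x ^^ n) y \<in> I"
    and K: "v1 \<in> K 1" "v2 \<in> K 1" and h: "homog 1 v1" "homog 1 v2"
    and indep: "\<And>c. v1 + psmult c v2 \<notin> I" "\<And>c. v2 + psmult c v1 \<notin> I" and "m > 0"
  shows "proj m x \<in> I"
proof (rule ccontr)
  assume m: "proj m x \<notin> I"
  \<comment> \<open>Degrees are collected modulo \<open>I\<close>, so that \<open>N\<close> is the
    top degree of the class of \<open>x\<close>, not of its representative.\<close>
  define A where "A = {j. proj j x \<notin> I}"
  have "proj j x \<noteq> 0" if "j \<in> A" for j using that I_closed(1) by (force simp: A_def)
  then have "A \<subseteq> {m. proj m x \<noteq> 0}" by blast
  then have A: "finite A" "m \<in> A"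
    using finite_subset[OF _ finite_degrees[OF x]] m by (auto simp: A_def)
  define N where "N = Max A"
  have N: "N > 0" "proj N x \<notin> I" "\<And>j. j > N \<Longrightarrow> proj j x \<in> I"
  proof -
    have "m \<le> N" using Max_ge[OF A] by (simp add: N_def)
    with \<open>m > 0\<close> show "N > 0" by simp
    have "N \<in> A" unfolding N_def using A by (intro Max_in) auto
    then show "proj N x \<notin> I" by (simp add: A_def)
    fix j assume "j > N"
    then have "j \<notin> A" using Max_ge[OF A(1), of j] by (auto simp: N_def)
    then show "proj j x \<in> I" by (simp add: A_def)
  qed
  have "U 1 (nat N) (proj N x)" using proj_W[OF x, of N] N(1) by (simp add: W_def)
  then obtain v where v: "v \<in> {v1, v2}" "\<And>n. (br (proj N x) ^^ n) v \<notin> I"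
    using not_ad_nilpotent[OF _ N(2) K indep] by blast
  then have vL: "v \<in> L" "homog 1 v" using K h KD(1) by auto
  obtain n where "(br x ^^ n) v \<in> I" using nil[OF vL(1)] by blast
  then have "proj (1 + int n * N) ((br x ^^ n) v) \<in> I" by (rule proj_I)
  moreover have "proj (1 + int n * N) ((br x ^^ n) v) - (br (proj N x) ^^ n) v \<in> I"
    using top_component_power[OF x vL N(3)] by blast
  ultimately have "(br (proj N x) ^^ n) v \<in> I"
    using I_closed(3) by fastforce
  with v(2) show False by blast
qed

end

section \<open>The subalgebra on which a given inner derivation is nilpotent\<close>

context lie_pair
begin

lemma funpow_bracket_add: "(bracket x ^^ n) (y + z) = (bracket x ^^ n) y + (bracket x ^^ n) z"
  by (induction n) (auto simp: bracket_add_right)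

lemma funpow_bracket_scale: "(bracket x ^^ n) (scale c y) = scale c ((bracket x ^^ n) y)"
  by (induction n) (auto simp: bracket_scale_right)

lemma funpow_bracket_I: "x \<in> L \<Longrightarrow> y \<in> I \<Longrightarrow> (bracket x ^^ n) y \<in> I"
  by (induction n) (auto simp: bracket_I)

lemma funpow_bracket_le:
  assumes "x \<in> L" "(bracket x ^^ m) y \<in> I" "m \<le> n"
  shows "(bracket x ^^ n) y \<in> I"
proof -
  have "(bracket x ^^ n) y = (bracket x ^^ (n - m)) ((bracket x ^^ m) y)"
    using assms(3) by (metis comp_apply funpow_add le_add_diff_inverse2)
  then show ?thesis using funpow_bracket_I[OF assms(1,2)] by simp
qed

text \<open>Induction on \<open>m + n\<close> replaces the binomial expansion: one application of
  \<open>bracket x\<close> gives two brackets, each with one exponent lowered.\<close>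

lemma funpow_bracket_leibniz:
  assumes "x \<in> L"
  shows "y \<in> L \<Longrightarrow> z \<in> L \<Longrightarrow> (bracket x ^^ m) y \<in> I \<Longrightarrow> (bracket x ^^ n) z \<in> I \<Longrightarrow>
    (bracket x ^^ (m + n)) (bracket y z) \<in> I"
proof (induction "m + n" arbitrary: m n y z)
  case 0
  then show ?case using bracket_I by auto
next
  case (Suc k)
  show ?case
  proof (cases "m = 0 \<or> n = 0")
    case True
    then have "bracket y z \<in> I" using Suc.prems bracket_I bracket_I_left by auto
    then show ?thesis using funpow_bracket_I[OF assms] by blast
  next
    case False
    then obtain m' n' where mn: "m = Suc m'" "n = Suc n'" by (meson not0_implies_Suc)
    have "(bracket x ^^ (m' + n)) (bracket (bracket x y) z) \<in> I"
      using Suc.prems Suc.hyps(2) mn assms by (intro Suc.hyps(1)) (auto simp: bracket_L funpow_swap1)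
    moreover have "(bracket x ^^ (m + n')) (bracket y (bracket x z)) \<in> I"
      using Suc.prems Suc.hyps(2) mn assms by (intro Suc.hyps(1)) (auto simp: bracket_L funpow_swap1)
    moreover have "m + n' = m' + n" by (simp add: mn)
    ultimately have "(bracket x ^^ (m' + n)) (bracket (bracket x y) z + bracket y (bracket x z)) \<in> I"
      by (simp only: funpow_bracket_add I_closed(2))
    moreover have "(bracket x ^^ (m + n)) (bracket y z) = (bracket x ^^ (m' + n)) (bracket x (bracket y z))"
      by (simp add: mn funpow_swap1)
    ultimately show ?thesis by (simp only: jacobi[of x y z])
  qed
qed

definition ad_nil :: "'a \<Rightarrow> 'a set" where
  "ad_nil x = {y \<in> L. \<exists>n. (bracket x ^^ n) y \<in> I}"

lemma subspace_ad_nil: "x \<in> L \<Longrightarrow> subspace (ad_nil x)"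
  unfolding subspace_def
proof (intro conjI ballI allI)
  assume x: "x \<in> L"
  show "0 \<in> ad_nil x" using L_closed(1) I_closed(1) by (auto simp: ad_nil_def intro: exI[of _ 0])
  fix y assume "y \<in> ad_nil x"
  then obtain n where y: "y \<in> L" "(bracket x ^^ n) y \<in> I" by (auto simp: ad_nil_def)
  show "scale c y \<in> ad_nil x" for c
    using y L_closed I_closed(5)[of "(bracket x ^^ n) y" c]
    by (auto simp: ad_nil_def intro!: exI[of _ n] simp: funpow_bracket_scale)
  fix z assume "z \<in> ad_nil x"
  then obtain k where z: "z \<in> L" "(bracket x ^^ k) z \<in> I" by (auto simp: ad_nil_def)
  show "y + z \<in> ad_nil x"
    using y z L_closed I_closed(2)[OF funpow_bracket_le[OF x y(2), of "max n k"] funpow_bracket_le[OF x z(2), of "max n k"]]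
    by (auto simp: ad_nil_def funpow_bracket_add intro!: exI[of _ "max n k"])
qed

lemma ad_nil_bracket: "x \<in> L \<Longrightarrow> y \<in> ad_nil x \<Longrightarrow> z \<in> ad_nil x \<Longrightarrow> bracket y z \<in> ad_nil x"
  using funpow_bracket_leibniz[of x] by (fastforce simp: ad_nil_def bracket_L)

lemma ad_nil_I: "y \<in> I \<Longrightarrow> y \<in> ad_nil x"
  using I_subset by (auto simp: ad_nil_def intro: exI[of _ 0])

lemma ad_nil_step: "y \<in> L \<Longrightarrow> bracket x y \<in> ad_nil x \<Longrightarrow> y \<in> ad_nil x"
  by (auto simp: ad_nil_def) (metis comp_apply funpow_Suc_right)

end

section \<open>Generalized Kac--Moody algebras\<close>

text \<open>The flag replaces the Chevalley involution: a statement for arbitrary \<open>s\<close>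
  covers the \<open>e\<close> and the \<open>f\<close> side at once, and \<open>sg s\<close> is the
  sign by which they differ.\<close>

definition sgen :: "bool \<Rightarrow> nat \<Rightarrow> gen" where
  "sgen s i = (if s then E i else F i)"

definition sg :: "bool \<Rightarrow> complex" where
  "sg s = (if s then 1 else -1)"

definition dgr :: "nat \<Rightarrow> bool \<Rightarrow> gen \<Rightarrow> int" where
  "dgr i s g = (if g = sgen s i then 1 else if g = sgen (\<not> s) i then -1 else 0)"

lemma sgen_eq [simp]: "sgen s i = sgen t j \<longleftrightarrow> s = t \<and> i = j"
  by (auto simp: sgen_def)

lemma sgen_ne_H [simp]: "sgen s i \<noteq> H k" "H k \<noteq> sgen s i"
  by (auto simp: sgen_def)

lemma dgr_H [simp]: "dgr i s (H k) = 0"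
  by (simp add: dgr_def)

lemma dgr_sgen: "dgr i s (sgen t j) = (if i = j then if s = t then 1 else -1 else 0)"
  by (auto simp: dgr_def)

locale gkm =
  fixes l d :: nat and a :: rmat and rt cor :: "nat \<Rightarrow> nat \<Rightarrow> complex"
  assumes matrix: "gkm_matrix l a" and indec: "indecomposable l a" and l2: "l \<ge> 2"
    and real: "realization l a d rt cor"
begin

definition gens :: "gen set" where
  "gens = {sgen s i | s i. i < l} \<union> {H k | k. k < d}"

abbreviation R where "R \<equiv> gkm_relations l a d rt cor"

lemma free_L_eq: "free_L l d = lie_gen (gel ` gens)"
proof -
  have "{gel (E i) | i. i < l} \<union> {gel (F i) | i. i < l} \<union> {gel (H k) | k. k < d} = gel ` gens"
    unfolding gens_def sgen_def by (auto simp: image_iff)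
  then show ?thesis by (simp add: free_L_def)
qed

abbreviation L where "L \<equiv> lie_gen (gel ` gens)"
abbreviation I where "I \<equiv> lie_ideal L R"

lemma gkm_ideal_eq: "gkm_ideal l a d rt cor = I"
  by (simp add: gkm_ideal_def free_L_eq)

lemma hsum_eq: "hsum n c = (\<Sum>k<n. psmult (c k) (gel (H k)))"
proof
  fix w
  have "(\<Sum>k<n. psmult (c k) (gel (H k))) w = (\<Sum>k<n. psmult (c k) (gel (H k)) w)"
    by (induction n) auto
  then show "hsum n c w = (\<Sum>k<n. psmult (c k) (gel (H k))) w"
    by (simp add: hsum_def psmult_def)
qed

lemma sgen_gens: "i < l \<Longrightarrow> sgen s i \<in> gens" and H_gens: "k < d \<Longrightarrow> H k \<in> gens"
  by (auto simp: gens_def)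

lemma sgen_L: "i < l \<Longrightarrow> gel (sgen s i) \<in> L" and H_L: "k < d \<Longrightarrow> gel (H k) \<in> L"
  by (auto intro!: lie_gen.base imageI sgen_gens H_gens)

lemma hsum_mem: "elt.subspace S \<Longrightarrow> (\<And>k. k < d \<Longrightarrow> gel (H k) \<in> S) \<Longrightarrow> hsum d c \<in> S"
  unfolding hsum_eq by (intro elt.subspace_sum elt.subspace_scale) auto

text \<open>Only the shape of a relator is recorded. The exponent in the Serre relators is left
  arbitrary, since degree and membership arguments do not depend on it; \<open>serre\<close> keeps
  the true exponent.\<close>

lemma relation_cases:
  assumes "r \<in> R"
  obtains i j where "i < l" "j < l" "i \<noteq> j" "r = br (gel (E i)) (gel (F j))"
  | i where "i < l" "r = br (gel (E i)) (gel (F i)) - hsum d (cor i)"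
  | k k' where "k < d" "k' < d" "r = br (gel (H k)) (gel (H k'))"
  | k s i where "k < d" "i < l" "r = br (gel (H k)) (gel (sgen s i)) - psmult (sg s * rt i k) (gel (sgen s i))"
  | s i j n where "i < l" "j < l" "i \<noteq> j" "a i i = 2" "r = ad_pow (gel (sgen s i)) n (gel (sgen s j))"
  | s i j where "i < l" "j < l" "a i j = 0" "r = br (gel (sgen s i)) (gel (sgen s j))"
  using assms unfolding gkm_relations_def
  apply (elim UnE CollectE exE conjE)
         apply (auto simp: elt_eqs split: if_splits)[1]
        apply blast
       subgoal for k i using that(4)[of k i True] by (simp add: elt_eqs sgen_def sg_def)
      subgoal for k i using that(4)[of k i False] by (simp add: elt_eqs sgen_def sg_def)
     subgoal for i j using that(5)[of i j True] by (simp add: sgen_def)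
    subgoal for i j using that(5)[of i j False] by (simp add: sgen_def)
   subgoal for i j using that(6)[of i j True] by (simp add: sgen_def)
  subgoal for i j using that(6)[of i j False] by (simp add: sgen_def)
  done

lemma ad_pow_mem:
  assumes "\<And>y. y \<in> S \<Longrightarrow> br x y \<in> S" "y \<in> S"
  shows "ad_pow x n y \<in> S"
  by (induction n) (use assms in auto)

lemma R_subset: "R \<subseteq> L"
proof
  fix r assume "r \<in> R"
  note sub = elt.subspace_diff[OF subspace_lie_gen] elt.subspace_scale[OF subspace_lie_gen]
  show "r \<in> L" using \<open>r \<in> R\<close>
    by (cases rule: relation_cases)
      (use sgen_L[of _ True] sgen_L[of _ False] in \<open>auto simp: sgen_def[of True] sgen_def[of False]
        intro!: sub lie_gen.brk sgen_L H_L hsum_mem subspace_lie_gen ad_pow_mem\<close>)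
qed

sublocale lie_pair psmult br L I
  using lie_pair_presentation[OF R_subset] .


text \<open>The value of the simple root \<alpha>\<open>_i\<close> at the Cartan element
  \<open>hsum d c\<close>.\<close>

definition coweight :: "nat \<Rightarrow> (nat \<Rightarrow> complex) \<Rightarrow> complex" where
  "coweight i c = (\<Sum>k<d. c k * rt i k)"

lemma relI: "r \<in> R \<Longrightarrow> r \<in> I"
  by (rule lie_ideal.base)

lemma H_H: "k < d \<Longrightarrow> k' < d \<Longrightarrow> br (gel (H k)) (gel (H k')) \<in> I"
  by (rule relI) (auto simp: gkm_relations_def)

lemma H_sgen: "k < d \<Longrightarrow> i < l \<Longrightarrow>
  br (gel (H k)) (gel (sgen s i)) - psmult (sg s * rt i k) (gel (sgen s i)) \<in> I"
proof (cases s)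
  case True
  assume "k < d" "i < l"
  then have "psub (br (gel (H k)) (gel (E i))) (psmult (rt i k) (gel (E i))) \<in> I"
    by (intro relI) (auto simp: gkm_relations_def)
  then show ?thesis by (simp add: True sgen_def sg_def psub_eq)
next
  case False
  assume "k < d" "i < l"
  then have "padd (br (gel (H k)) (gel (F i))) (psmult (rt i k) (gel (F i))) \<in> I"
    by (intro relI) (auto simp: gkm_relations_def)
  then show ?thesis by (simp add: False sgen_def sg_def padd_eq)
qed

lemma E_F: "i < l \<Longrightarrow> j < l \<Longrightarrow>
  br (gel (E i)) (gel (F j)) - (if i = j then hsum d (cor i) else 0) \<in> I"
proof -
  assume "i < l" "j < l"
  then have "psub (br (gel (E i)) (gel (F j))) (if i = j then hsum d (cor i) else pzero) \<in> I"
    by (intro relI) (auto simp: gkm_relations_def)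
  then show ?thesis by (cases "i = j") (simp_all add: psub_eq pzero_eq)
qed

lemma sgen_sgen:
  assumes "i < l" "j < l"
  shows "br (gel (sgen s i)) (gel (sgen (\<not> s) j)) - psmult (sg s) (if i = j then hsum d (cor i) else 0) \<in> I"
proof (cases s)
  case True
  then show ?thesis using E_F[OF assms] by (simp add: sgen_def sg_def)
next
  case False
  have "- (br (gel (E j)) (gel (F i)) - (if j = i then hsum d (cor j) else 0)) \<in> I"
    by (rule I_closed(4)) (rule E_F[OF assms(2,1)])
  also have "- (br (gel (E j)) (gel (F i)) - (if j = i then hsum d (cor j) else 0))
      = br (gel (sgen s i)) (gel (sgen (\<not> s) j)) - psmult (sg s) (if i = j then hsum d (cor i) else 0)"
    using elt.bracket_anti[of "gel (F i)" "gel (E j)"] by (simp add: False sgen_def sg_def)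
  finally show ?thesis .
qed

lemma serre:
  assumes "i < l" "j < l" "i \<noteq> j" "a i i = 2"
  shows "ad_pow (gel (sgen s i)) (nat (1 - \<lfloor>a i j\<rfloor>)) (gel (sgen s j)) \<in> I"
proof -
  have "ad_pow (gel (E i)) (nat (1 - \<lfloor>a i j\<rfloor>)) (gel (E j)) \<in> R"
    "ad_pow (gel (F i)) (nat (1 - \<lfloor>a i j\<rfloor>)) (gel (F j)) \<in> R"
    unfolding gkm_relations_def using assms by blast+
  then show ?thesis using relI by (simp add: sgen_def)
qed

lemma hsum_L: "hsum d c \<in> L"
  by (intro hsum_mem subspace_L H_L)

lemma sum_mem_I: "(\<And>j. j \<in> A \<Longrightarrow> f j \<in> I) \<Longrightarrow> sum f A \<in> I"
  by (rule elt.subspace_sum[OF subspace_I])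

lemma hsum_H: "k < d \<Longrightarrow> br (gel (H k)) (hsum d c) \<in> I"
  unfolding hsum_eq elt.bracket_sum_right
  by (intro sum_mem_I) (simp add: elt.bracket_scale_right H_H I_closed(5))

lemma hsum_hsum: "br (hsum d c) (hsum d c') \<in> I"
proof -
  have "br (\<Sum>k<d. psmult (c k) (gel (H k))) (hsum d c') \<in> I"
    unfolding elt.bracket_sum_left
    by (intro sum_mem_I) (simp add: elt.bracket_scale_left hsum_H I_closed(5))
  then show ?thesis by (simp only: hsum_eq)
qed

lemma hsum_sgen:
  assumes "i < l"
  shows "br (hsum d c) (gel (sgen s i)) - psmult (sg s * coweight i c) (gel (sgen s i)) \<in> I"
proof -
  let ?x = "gel (sgen s i)"
  have "(\<Sum>k<d. psmult (c k) (br (gel (H k)) ?x - psmult (sg s * rt i k) ?x)) \<in> I"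
    using H_sgen[OF _ assms] by (intro sum_mem_I I_closed(5)) auto
  also have "(\<Sum>k<d. psmult (c k) (br (gel (H k)) ?x - psmult (sg s * rt i k) ?x))
      = br (hsum d c) ?x - (\<Sum>k<d. psmult (c k * (sg s * rt i k)) ?x)"
    by (simp only: elt.scale_right_diff_distrib sum_subtractf hsum_eq elt.bracket_sum_left
        elt.bracket_scale_left elt.scale_scale)
  also have "(\<Sum>k<d. psmult (c k * (sg s * rt i k)) ?x) = psmult (sg s * coweight i c) ?x"
    by (simp only: elt.scale_sum_left[symmetric]) (simp add: coweight_def sum_distrib_left mult.left_commute)
  finally show ?thesis .
qed

lemma coweight_cor: "i < l \<Longrightarrow> j < l \<Longrightarrow> coweight j (cor i) = complex_of_real (a i j)"
proof -
  assume "i < l" "j < l"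
  then have "(\<Sum>k<d. rt j k * cor i k) = complex_of_real (a i j)"
    using real unfolding realization_def by blast
  then show ?thesis by (simp add: coweight_def mult.commute)
qed

subsection \<open>Real simple root vectors are locally ad-nilpotent\<close>

text \<open>\<open>ad_nil\<close> of the root vector is a subalgebra, so generators suffice. The
  bracket with it sends an opposite generator into \<hh>, sends \<hh> to multiples of the root
  vector, and kills the root vector itself; on the same side the Serre relations apply.\<close>

lemma real_ad_nil:
  assumes i: "i < l" "a i i = 2"
  shows "L \<subseteq> ad_nil (gel (sgen s i))"
proof -
  let ?x = "gel (sgen s i)"
  let ?T = "ad_nil ?x"
  have x: "?x \<in> L" by (rule sgen_L[OF i(1)])
  have T: "elt.subspace ?T" by (rule subspace_ad_nil[OF x])
  note T_closed = elt.subspace_add[OF T] elt.subspace_scale[OF T] elt.subspace_diff[OF T] elt.subspace_neg[OF T]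
  have cong: "y \<in> ?T" if "y - z \<in> I" "z \<in> ?T" for y z
    using T_closed(1)[OF that(2) ad_nil_I[OF that(1)]] by simp
  have xT: "?x \<in> ?T"
    using ad_nil_step[OF x] ad_nil_I[OF I_closed(1)] by simp
  have HT: "gel (H k) \<in> ?T" if k: "k < d" for k
  proof (rule ad_nil_step[OF H_L[OF k]])
    have "br (gel (H k)) ?x \<in> ?T" by (rule cong[OF H_sgen[OF k i(1)] T_closed(2)[OF xT]])
    then show "br ?x (gel (H k)) \<in> ?T" using T_closed(4) by (simp add: elt.bracket_anti[of ?x "gel (H k)"])
  qed
  have opp: "gel (sgen (\<not> s) j) \<in> ?T" if j: "j < l" for j
  proof (rule ad_nil_step[OF sgen_L[OF j]], rule cong[OF sgen_sgen[OF i(1) j]])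
    show "psmult (sg s) (if i = j then hsum d (cor i) else 0) \<in> ?T"
      using hsum_mem[OF T HT] elt.subspace_0[OF T] by (intro T_closed(2)) auto
  qed
  have same: "gel (sgen s j) \<in> ?T" if j: "j < l" for j
  proof (cases "i = j")
    case False
    then show ?thesis using serre[OF i(1) j _ i(2)] sgen_L[OF j] by (auto simp: ad_nil_def ad_pow_def)
  qed (use xT in simp)
  have "gel (sgen t j) \<in> ?T" if "j < l" for t j
    using same[OF that] opp[OF that] by (cases "t = s") auto
  then have "gel ` gens \<subseteq> ?T" using HT by (auto simp: gens_def)
  then show ?thesis using lie_gen_least[of _ _ ?T] T ad_nil_bracket[OF x] by blast
qed

lemma g_B_subset: "g_B l a d rt cor \<subseteq> g_nil l a d rt cor"
proof -
  have mem: "gel (sgen s i) \<in> g_nil_o l a d rt cor" if "i < l" "a i i = 2" for s i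
    using real_ad_nil[OF that, of s] sgen_L[OF that(1), of s]
    unfolding g_nil_o_def free_L_eq gkm_ideal_eq ad_pow_def ad_nil_def by blast
  have "{gel (E i) |i. i < l \<and> a i i = 2} \<union> {gel (F i) |i. i < l \<and> a i i = 2} \<union> I
      \<subseteq> lie_gen (g_nil_o l a d rt cor \<union> I)"
    using mem[of _ True] mem[of _ False] by (auto simp: sgen_def intro: lie_gen.base)
  then show ?thesis
    unfolding g_B_def g_nil_def gkm_ideal_eq
    using lie_gen_least[OF _ _ subspace_lie_gen lie_gen.brk] by blast
qed

subsection \<open>Imaginary degrees\<close>

lemma neighbour:
  assumes "i < l"
  obtains k where "k < l" "k \<noteq> i" "a k i \<noteq> 0"
proof -
  obtain j where j: "j < l" "j \<noteq> i" using l2 by (metis One_nat_def Suc_1 assms lessI less_le_trans nat_neq_iff zero_less_Suc)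
  have "(i, j) \<in> (dynkin_edges l a)\<^sup>*" using indec assms j by (simp add: indecomposable_def)
  then obtain k where "(i, k) \<in> dynkin_edges l a" using j(2) by (metis converse_rtranclE)
  then have "k < l" "k \<noteq> i" "a i k \<noteq> 0" by (auto simp: dynkin_edges_def)
  \<comment> \<open>The transposed entry is the useful one: \<open>a k i\<close> is the eigenvalue
    of the coroot of \<open>k\<close> on the root vector of \<open>i\<close>.\<close>
  moreover have "a k i \<noteq> 0" using matrix assms \<open>k < l\<close> \<open>a i k \<noteq> 0\<close> by (auto simp: gkm_matrix_def)
  ultimately show thesis using that by blast
qed

end

text \<open>Homogeneity holds for real and imaginary \<open>i\<close> alike: relators are bracket
  monomials, possibly corrected by a term of the same degree.\<close>

lemma graded_presentation_dgr:
  assumes "gkm l d a rt cor"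
  shows "graded_presentation (dgr i s) (gkm.gens l d) (gkm_relations l a d rt cor)"
proof -
  interpret gkm l d a rt cor by (rule assms)
  interpret letter_grading "dgr i s" .
  have hd: "homog m (x - y)" if "homog m x" "homog m y" for m x y
    using that unfolding homog_def by (metis diff_self fun_diff_def)
  have hm: "homog m (psmult c x)" if "homog m x" for m c x
    using that by (auto simp: homog_def psmult_def)
  have "homog m (x + y)" if "homog m x" "homog m y" for m x y
    using that unfolding homog_def by (metis add_0 plus_fun_apply)
  moreover have "homog 0 0" by (simp add: homog_def)
  ultimately have sub: "elt.subspace {x. homog 0 x}" using hm by (simp add: elt.subspace_def)
  have hs: "homog 0 (hsum d c)" for c
    using hsum_mem[OF sub, of c] homog_gel[of "H k" for k] by (simp only: mem_Collect_eq dgr_H)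
  have hp: "homog (dgr i s h + int n * dgr i s g) (ad_pow (gel g) n (gel h))" for g h n
  proof (induction n)
    case 0 show "homog (dgr i s h + int 0 * dgr i s g) (ad_pow (gel g) 0 (gel h))" using homog_gel by simp
  next
    case (Suc n)
    show "homog (dgr i s h + int (Suc n) * dgr i s g) (ad_pow (gel g) (Suc n) (gel h))"
      using homog_br[OF homog_gel Suc.IH, of g] by (simp add: algebra_simps)
  qed
  show ?thesis
  proof
    show "R \<subseteq> lie_gen (gel ` gens)" by (rule R_subset)
    show "dgr i s g \<in> {-1,0,1}" for g by (simp add: dgr_def)
    fix r assume "r \<in> R"
    then show "\<exists>m. homog m r"
    proof (cases rule: relation_cases)
      case (1 i' j) then show ?thesis using homog_br[OF homog_gel homog_gel] by blast
    next
      case (2 j)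
      have "dgr i s (E j) + dgr i s (F j) = 0" by (auto simp: dgr_def sgen_def)
      then show ?thesis using homog_br[OF homog_gel homog_gel, of "E j" "F j"] 2 hd hs by metis
    next
      case (3 k k') then show ?thesis using homog_br[OF homog_gel homog_gel] by blast
    next
      case (4 k t j)
      have "homog (dgr i s (sgen t j)) (br (gel (H k)) (gel (sgen t j)))"
        using homog_br[OF homog_gel homog_gel, of "H k" "sgen t j"] by simp
      then show ?thesis using 4 hd hm homog_gel by blast
    next
      case (5 t i' j n) then show ?thesis using hp by blast
    next
      case (6 t i' j) then show ?thesis using homog_br[OF homog_gel homog_gel] by blast
    qed
  qed
qed

text \<open>A Serre relator iterates a root vector of a real index, hence different from
  \<open>i\<close>. Its adjoint action has degree 0, so the relator stays in the same
  \<open>K\<close> as the vector it is applied to.\<close>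

lemma local_presentation_dgr:
  assumes "gkm l d a rt cor" and i: "a i i \<noteq> 2"
  shows "local_presentation (dgr i s) (gkm.gens l d) (gkm_relations l a d rt cor)"
proof -
  interpret gkm l d a rt cor by (rule assms)
  interpret p: graded_presentation "dgr i s" gens R by (rule graded_presentation_dgr[OF assms(1)])
  have dr: "dgr i s g \<in> {-1,0,1}" for g by (rule p.dg_range)
  have HK: "gel (H k) \<in> p.K 0" if "k < d" for k using p.gel_K[OF H_gens[OF that]] by simp
  have XK: "gel (sgen t j) \<in> p.K (dgr i s (sgen t j))" if "j < l" for t j using p.gel_K[OF sgen_gens[OF that]] .
  show ?thesis
  proof
    fix r assume "r \<in> R"
    then show "\<exists>m. r \<in> p.K m"
    proof (cases rule: relation_cases)
      case (1 i' j)
      have "dgr i s (sgen True i') + dgr i s (sgen False j) \<in> {-1,0,1}"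
        using 1 by (auto simp: dgr_sgen)
      then show ?thesis using p.K_bracket[OF XK XK dr dr, of i' j True False] 1 by (auto simp: sgen_def)
    next
      case (2 j)
      have "dgr i s (sgen True j) + dgr i s (sgen False j) = 0" by (auto simp: dgr_sgen)
      then have "br (gel (E j)) (gel (F j)) \<in> p.K 0"
        using p.K_bracket[OF XK XK dr dr, of j j True False] 2 by (auto simp: sgen_def)
      then show ?thesis using 2 elt.subspace_diff[OF p.subspace_K] hsum_mem[OF p.subspace_K HK] by blast
    next
      case (3 k k') then show ?thesis using p.K_bracket[OF HK HK, of k k'] by auto
    next
      case (4 k t j)
      have "br (gel (H k)) (gel (sgen t j)) \<in> p.K (dgr i s (sgen t j))"
        using p.K_bracket[OF HK XK _ dr, of k j t] 4 dr by simp
      then show ?thesis using 4 XK elt.subspace_diff[OF p.subspace_K] elt.subspace_scale[OF p.subspace_K] by blast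
    next
      case (5 t i' j n)
      then have "i' \<noteq> i" using i by auto
      then have "dgr i s (sgen t i') = 0" by (simp add: dgr_sgen)
      then have "br (gel (sgen t i')) y \<in> p.K (dgr i s (sgen t j))" if "y \<in> p.K (dgr i s (sgen t j))" for y
        using p.K_bracket[OF XK that dr dr, of i' t] 5 dr by simp
      then show ?thesis using 5 XK ad_pow_mem by blast
    next
      case (6 t i' j)
      show ?thesis
      proof (cases "i' = j")
        \<comment> \<open>This occurs when a diagonal entry is 0. The formal degree may be 2 or -2,
          but the bracket of an element with itself is already 0 in the free algebra.\<close>
        case True then show ?thesis using 6 p.K_0 by auto
      next
        case False
        then have "dgr i s (sgen t i') + dgr i s (sgen t j) \<in> {-1,0,1}" by (auto simp: dgr_sgen)
        then show ?thesis using p.K_bracket[OF XK XK dr dr] 6 by blast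
      qed
    qed
  qed
qed

context gkm
begin

text \<open>The two elements of degree one are \<open>e\<close> and \<open>[e_k, e]\<close> for a
  neighbour \<open>k\<close>. Bracketing with \<open>f_k\<close> kills the first and sends the
  second to \<open>- a k i\<close> times the first, which makes them independent modulo
  \<open>I\<close>.\<close>

lemma nil_positive_degree:
  assumes x: "x \<in> g_nil_o l a d rt cor" and i: "i < l" "a i i \<noteq> 2" and m: "m > 0"
  shows "letter_grading.proj (dgr i s) m x \<in> I"
proof -
  interpret p: local_presentation "dgr i s" gens R by (rule local_presentation_dgr[OF gkm_axioms i(2)])
  have xL: "x \<in> L" and nil: "\<And>y. y \<in> L \<Longrightarrow> \<exists>n. (br x ^^ n) y \<in> I"
    using x by (auto simp: g_nil_o_def free_L_eq gkm_ideal_eq ad_pow_def)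
  let ?e = "gel (sgen s i)"
  show ?thesis
  proof (cases "?e \<in> I")
    \<comment> \<open>This case does not occur, but treating it is cheaper than proving \<open>\<gg>\<close> nontrivial.\<close>
    case True
    have "gel g \<in> I" if "dgr i s g = 1" for g
      using that True by (auto simp: dgr_def split: if_splits)
    then show ?thesis using p.positive_part_trivial[OF _ xL m] by blast
  next
    case False
    obtain k where k: "k < l" "k \<noteq> i" "a k i \<noteq> 0" using neighbour[OF i(1)] by blast
    let ?ek = "gel (sgen s k)" and ?f = "gel (sgen (\<not> s) k)"
    define e2 where "e2 = br ?ek ?e"
    define c' where "c' = complex_of_real (a k i)"
    have c': "c' \<noteq> 0" using k by (simp add: c'_def)
    have eL: "?e \<in> L" "?ek \<in> L" "?f \<in> L" using sgen_L i k by auto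
    have K1: "?e \<in> p.K 1" using p.gel_K[OF sgen_gens[OF i(1)], of s] by (simp add: dgr_sgen)
    have "?ek \<in> p.K 0" using p.gel_K[OF sgen_gens[OF k(1)], of s] k by (simp add: dgr_sgen)
    then have K2: "e2 \<in> p.K 1" using p.K_bracket[OF _ K1, of ?ek 0] by (simp add: e2_def)
    have h1: "p.homog 1 ?e" using p.homog_gel[of "sgen s i"] by (simp add: dgr_sgen)
    have "p.homog 0 ?ek" using p.homog_gel[of "sgen s k"] k by (simp add: dgr_sgen)
    then have h2: "p.homog 1 e2" using p.homog_br[OF _ h1, of 0 ?ek] by (simp add: e2_def)
    have fe: "br ?f ?e \<in> I"
      using sgen_sgen[OF k(1) i(1), of "\<not> s"] k(2) by simp
    have "br ?f ?ek - psmult (sg (\<not> s)) (hsum d (cor k)) \<in> I"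
      using sgen_sgen[OF k(1) k(1), of "\<not> s"] by simp
    then have "br (br ?f ?ek - psmult (sg (\<not> s)) (hsum d (cor k))) ?e \<in> I"
      using bracket_I_left eL by blast
    then have 1: "br (br ?f ?ek) ?e - psmult (sg (\<not> s)) (br (hsum d (cor k)) ?e) \<in> I"
      by (simp only: elt.bracket_linear)
    have "psmult (sg (\<not> s)) (br (hsum d (cor k)) ?e - psmult (sg s * c') ?e) \<in> I"
      using hsum_sgen[OF i(1), of "cor k" s] I_closed(5) by (simp add: coweight_cor[OF k(1) i(1)] c'_def)
    then have 2: "psmult (sg (\<not> s)) (br (hsum d (cor k)) ?e) - psmult (sg (\<not> s) * (sg s * c')) ?e \<in> I"
      by (simp only: elt.scale_right_diff_distrib elt.scale_scale)
    have "br ?f e2 - psmult (sg (\<not> s) * (sg s * c')) ?e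
        = (br (br ?f ?ek) ?e - psmult (sg (\<not> s)) (br (hsum d (cor k)) ?e))
        + (psmult (sg (\<not> s)) (br (hsum d (cor k)) ?e) - psmult (sg (\<not> s) * (sg s * c')) ?e)
        + br ?ek (br ?f ?e)"
      unfolding e2_def elt.jacobi[of ?f ?ek ?e] by simp
    also have "\<dots> \<in> I" by (intro I_closed(2) 1 2 bracket_I eL fe)
    also have "sg (\<not> s) * (sg s * c') = - c'" by (simp add: sg_def)
    finally have fe2: "br ?f e2 - psmult (- c') ?e \<in> I" .
    have mult: "c = 0" if "psmult c ?e \<in> I" for c
    proof (rule ccontr)
      assume "c \<noteq> 0"
      then have "psmult (1 / c) (psmult c ?e) = ?e" by simp
      with I_closed(5)[OF that, of "1 / c"] have "?e \<in> I" by (simp only:)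
      with False show False by blast
    qed
    have "?e + psmult c e2 \<notin> I" for c
    proof
      assume I: "?e + psmult c e2 \<in> I"
      have "psmult (c * (- c')) ?e = br ?f (?e + psmult c e2) - br ?f ?e
          - psmult c (br ?f e2 - psmult (- c') ?e)"
        by (simp only: elt.bracket_linear elt.scale_right_diff_distrib elt.scale_scale) simp
      also have "\<dots> \<in> I" by (intro I_closed(3) I_closed(5) bracket_I eL I fe fe2)
      finally have "c * (- c') = 0" by (rule mult)
      then have "c = 0" using c' by simp
      with I False show False by simp
    qed
    moreover have "e2 + psmult c ?e \<notin> I" for c
    proof
      assume I: "e2 + psmult c ?e \<in> I"
      have "psmult (- c') ?e = br ?f (e2 + psmult c ?e) - psmult c (br ?f ?e)
          - (br ?f e2 - psmult (- c') ?e)"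
        by (simp only: elt.bracket_linear) simp
      also have "\<dots> \<in> I" by (intro I_closed(3) I_closed(5) bracket_I eL I fe fe2)
      finally have "- c' = 0" by (rule mult)
      with c' show False by simp
    qed
    ultimately show ?thesis
      using p.positive_part_nilpotent[OF xL nil K1 K2 h1 h2 _ _ m] by blast
  qed
qed

subsection \<open>Triangular decomposition\<close>

text \<open>A subalgebra of the free Lie algebra itself and not a preimage containing
  \<open>I\<close>: statements about its degrees hold exactly, not just modulo
  \<open>I\<close>.\<close>

definition nilrad :: "bool \<Rightarrow> nat set \<Rightarrow> elt set" where
  "nilrad s A = lie_gen {gel (sgen s j) | j. j < l \<and> j \<notin> A}"

lemma nilrad_gel: "j < l \<Longrightarrow> j \<notin> A \<Longrightarrow> gel (sgen s j) \<in> nilrad s A"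
  unfolding nilrad_def by (rule lie_gen.base) blast

lemma subspace_nilrad: "elt.subspace (nilrad s A)"
  by (simp add: nilrad_def subspace_lie_gen)

lemma nilrad_br: "x \<in> nilrad s A \<Longrightarrow> y \<in> nilrad s A \<Longrightarrow> br x y \<in> nilrad s A"
  unfolding nilrad_def by (rule lie_gen.brk)

lemma nilrad_L: "nilrad s A \<subseteq> L"
proof
  fix x assume "x \<in> nilrad s A"
  then show "x \<in> L"
    unfolding nilrad_def
    by (rule lie_gen_least) (auto intro: sgen_L subspace_L bracket_L)
qed

lemma br_span:
  assumes "elt.subspace Q" "\<And>y. y \<in> S \<Longrightarrow> br x y \<in> Q" "y \<in> elt.span S"
  shows "br x y \<in> Q"
proof -
  have "elt.subspace {y. br x y \<in> Q}"
    using assms(1) by (auto simp: elt.subspace_def elt.bracket_linear)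
  then have "elt.span S \<subseteq> {y. br x y \<in> Q}" using assms(2) by (intro elt.span_minimal) auto
  with assms(3) show ?thesis by blast
qed

lemma br_span_left:
  assumes "elt.subspace Q" "\<And>y. y \<in> S \<Longrightarrow> br y x \<in> Q" "y \<in> elt.span S"
  shows "br y x \<in> Q"
proof -
  have "elt.subspace {y. br y x \<in> Q}"
    using assms(1) by (auto simp: elt.subspace_def elt.bracket_linear)
  then have "elt.span S \<subseteq> {y. br y x \<in> Q}" using assms(2) by (intro elt.span_minimal) auto
  with assms(3) show ?thesis by blast
qed

lemma in_span_cong: "y - z \<in> I \<Longrightarrow> I \<subseteq> S \<Longrightarrow> z \<in> elt.span S \<Longrightarrow> y \<in> elt.span S"
  using elt.span_add[of "y - z" S z] elt.span_base[of "y - z" S] by auto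

text \<open>The target span is stable under brackets with \<open>nilrad s A\<close>. By Jacobi, the
  \<open>y\<close> that \<open>br (hsum d c)\<close> sends into it form a subalgebra, so generators
  decide.\<close>

lemma nilrad_hsum: "y \<in> nilrad s A \<Longrightarrow> br (hsum d c) y \<in> elt.span (nilrad s A \<union> I)"
proof -
  let ?Q = "elt.span (nilrad s A \<union> I)"
  assume y: "y \<in> nilrad s A"
  have Q: "br u z \<in> ?Q" if "u \<in> ?Q" "z \<in> nilrad s A" for u z
  proof (rule br_span_left[OF elt.subspace_span _ that(1)])
    fix v assume "v \<in> nilrad s A \<union> I"
    then show "br v z \<in> ?Q"
      using that(2) nilrad_br nilrad_L bracket_I_left by (intro elt.span_base) blast
  qed
  have "y \<in> {y \<in> nilrad s A. br (hsum d c) y \<in> ?Q}"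
  proof (rule lie_gen_least[OF y[unfolded nilrad_def]])
    have "br (hsum d c) (gel (sgen s j)) \<in> ?Q" if "j < l" "j \<notin> A" for j
      using nilrad_gel[OF that, of s]
      by (intro in_span_cong[OF hsum_sgen[OF that(1)]] elt.span_scale elt.span_base) blast+
    then show "{gel (sgen s j) |j. j < l \<and> j \<notin> A} \<subseteq> {y \<in> nilrad s A. br (hsum d c) y \<in> ?Q}"
      using nilrad_gel by auto
    show "elt.subspace {y \<in> nilrad s A. br (hsum d c) y \<in> ?Q}"
      using subspace_nilrad[of s A] elt.span_zero elt.span_add elt.span_scale
      by (auto simp: elt.subspace_def elt.bracket_linear)
    fix u v assume u: "u \<in> {y \<in> nilrad s A. br (hsum d c) y \<in> ?Q}" and v: "v \<in> {y \<in> nilrad s A. br (hsum d c) y \<in> ?Q}"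
    have "br u (br (hsum d c) v) = - br (br (hsum d c) v) u" by (rule elt.bracket_anti)
    then have "br u (br (hsum d c) v) \<in> ?Q" using Q[of "br (hsum d c) v" u] u v elt.span_neg by auto
    then have "br (br (hsum d c) u) v + br u (br (hsum d c) v) \<in> ?Q"
      using Q[of "br (hsum d c) u" v] u v by (intro elt.span_add) auto
    then show "br u v \<in> {y \<in> nilrad s A. br (hsum d c) y \<in> ?Q}"
      using u v nilrad_br by (simp add: elt.jacobi[of "hsum d c" u v])
  qed
  then show ?thesis by blast
qed

lemma sgen_hsum: "j < l \<Longrightarrow> br (gel (sgen s j)) (hsum d c) \<in> elt.span (nilrad s {} \<union> I)"
  using elt.span_neg[OF nilrad_hsum[OF nilrad_gel[of j "{}" s]], of c]
  by (simp add: elt.bracket_anti[of "gel (sgen s j)" "hsum d c"])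

text \<open>The same derivation argument; the Cartan summand is needed because the bracket of
  \<open>e_j\<close> and \<open>f_j\<close> is a coroot.\<close>

lemma sgen_nilrad:
  assumes j: "j < l" and y: "y \<in> nilrad (\<not> s) {}"
  shows "br (gel (sgen s j)) y \<in> elt.span (range (hsum d) \<union> nilrad (\<not> s) {} \<union> I)"
proof -
  let ?Q = "elt.span (range (hsum d) \<union> nilrad (\<not> s) {} \<union> I)" and ?x = "gel (sgen s j)"
  have sub: "elt.span (nilrad (\<not> s) {} \<union> I) \<subseteq> ?Q" by (rule elt.span_mono) blast
  have Q: "br u z \<in> ?Q" if "u \<in> ?Q" "z \<in> nilrad (\<not> s) {}" for u z
  proof (rule br_span_left[OF elt.subspace_span _ that(1)])
    fix v assume "v \<in> range (hsum d) \<union> nilrad (\<not> s) {} \<union> I"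
    then consider c where "v = hsum d c" | "v \<in> nilrad (\<not> s) {}" | "v \<in> I" by blast
    then show "br v z \<in> ?Q"
    proof cases
      case 1 then show ?thesis using nilrad_hsum[OF that(2)] sub by blast
    next
      case 2 then show ?thesis using nilrad_br that(2) by (intro elt.span_base) blast
    next
      case 3 then show ?thesis using bracket_I_left that(2) nilrad_L by (intro elt.span_base) blast
    qed
  qed
  have "y \<in> {y \<in> nilrad (\<not> s) {}. br ?x y \<in> ?Q}"
  proof (rule lie_gen_least[OF y[unfolded nilrad_def]])
    have "br ?x (gel (sgen (\<not> s) k)) \<in> ?Q" if k: "k < l" for k
    proof (rule in_span_cong[OF sgen_sgen[OF j k]])
      have "hsum d (cor j) \<in> ?Q" by (intro elt.span_base) blast
      moreover have "(if b then u else 0) \<in> ?Q" if "u \<in> ?Q" for b u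
        using that elt.span_zero by (cases b) simp_all
      ultimately show "psmult (sg s) (if j = k then hsum d (cor j) else 0) \<in> ?Q"
        by (intro elt.span_scale) blast
    qed blast
    then show "{gel (sgen (\<not> s) k) |k. k < l \<and> k \<notin> {}} \<subseteq> {y \<in> nilrad (\<not> s) {}. br ?x y \<in> ?Q}"
      using nilrad_gel by auto
    show "elt.subspace {y \<in> nilrad (\<not> s) {}. br ?x y \<in> ?Q}"
      using subspace_nilrad[of "\<not> s" "{}"] elt.span_zero elt.span_add elt.span_scale
      by (auto simp: elt.subspace_def elt.bracket_linear)
    fix u v assume u: "u \<in> {y \<in> nilrad (\<not> s) {}. br ?x y \<in> ?Q}" and v: "v \<in> {y \<in> nilrad (\<not> s) {}. br ?x y \<in> ?Q}"
    have "br u (br ?x v) = - br (br ?x v) u" by (rule elt.bracket_anti)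
    then have "br u (br ?x v) \<in> ?Q" using Q[of "br ?x v" u] u v elt.span_neg by auto
    then have "br (br ?x u) v + br u (br ?x v) \<in> ?Q"
      using Q[of "br ?x u" v] u v by (intro elt.span_add) auto
    then show "br u v \<in> {y \<in> nilrad (\<not> s) {}. br ?x y \<in> ?Q}"
      using u v nilrad_br by (simp add: elt.jacobi[of ?x u v])
  qed
  then show ?thesis by blast
qed

lemma hsum_unit: "k < d \<Longrightarrow> gel (H k) = hsum d (\<lambda>j. if j = k then 1 else 0)"
  by (rule ext) (simp add: hsum_def if_distrib[of "\<lambda>c. c * _"] cong: if_cong)

text \<open>The span contains all generators and is stable under bracketing with each of
  them.\<close>

lemma triangular_span:
  assumes "x \<in> L"
  shows "x \<in> elt.span (nilrad True {} \<union> nilrad False {} \<union> range (hsum d) \<union> I)"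
proof -
  let ?S = "nilrad True {} \<union> nilrad False {} \<union> range (hsum d) \<union> I"
  have S: "nilrad s {} \<subseteq> ?S" for s by (cases s) auto
  have sub: "elt.span (nilrad s {} \<union> I) \<subseteq> elt.span ?S"
    "elt.span (range (hsum d) \<union> nilrad s {} \<union> I) \<subseteq> elt.span ?S" for s
    using S[of s] by (intro elt.span_mono; blast)+
  have Hs: "br (hsum d c) y \<in> elt.span ?S" if "y \<in> ?S" for c y
  proof -
    consider s where "y \<in> nilrad s {}" | c' where "y = hsum d c'" | "y \<in> I" using \<open>y \<in> ?S\<close> by blast
    then show ?thesis
    proof cases
      case 1 then show ?thesis using nilrad_hsum sub by blast
    next
      case 2 then show ?thesis using hsum_hsum by (auto intro: elt.span_base)
    next
      case 3 then show ?thesis using bracket_I[OF hsum_L] by (auto intro: elt.span_base)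
    qed
  qed
  have Xs: "br (gel (sgen s j)) y \<in> elt.span ?S" if "y \<in> ?S" and j: "j < l" for s j y
  proof -
    consider "y \<in> nilrad s {}" | "y \<in> nilrad (\<not> s) {}" | c' where "y = hsum d c'" | "y \<in> I"
      using \<open>y \<in> ?S\<close> by (cases s) auto
    then show ?thesis
    proof cases
      case 1
      then have "br (gel (sgen s j)) y \<in> nilrad s {}" using nilrad_br[OF nilrad_gel[OF j]] by simp
      then show ?thesis using S[of s] by (intro elt.span_base) blast
    next
      case 2 then show ?thesis using sgen_nilrad[OF j] sub by blast
    next
      case 3 then show ?thesis using sgen_hsum[OF j] sub by blast
    next
      case 4 then show ?thesis using bracket_I[OF sgen_L[OF j]] by (auto intro: elt.span_base)
    qed
  qed
  show ?thesis
  proof (rule lie_gen_induct_ad[OF assms _ elt.subspace_span])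
    have "gel (sgen s j) \<in> elt.span ?S" if "j < l" for s j
      using nilrad_gel[OF that, of "{}" s] S[of s] by (intro elt.span_base) auto
    moreover have "gel (H k) \<in> elt.span ?S" if "k < d" for k
      using hsum_unit[OF that] by (auto intro: elt.span_base)
    ultimately show "gel ` gens \<subseteq> elt.span ?S" by (auto simp: gens_def)
    fix x y assume "x \<in> gel ` gens" and y: "y \<in> elt.span ?S"
    then consider s j where "j < l" "x = gel (sgen s j)" | c where "x = hsum d c"
      by (auto simp: gens_def hsum_unit)
    then show "br x y \<in> elt.span ?S"
      using br_span[OF elt.subspace_span _ y, of x] Xs Hs by cases blast+
  qed
qed

lemma subspace_hsum: "elt.subspace (range (hsum d))"
  unfolding elt.subspace_def
proof (intro conjI ballI allI)
  have "hsum d (\<lambda>k. 0) = 0" by (simp add: hsum_eq)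
  then show "0 \<in> range (hsum d)" by (metis rangeI)
next
  fix x y assume "x \<in> range (hsum d)" "y \<in> range (hsum d)"
  then obtain c c' where "x = hsum d c" "y = hsum d c'" by blast
  then have "x + y = hsum d (\<lambda>k. c k + c' k)"
    by (simp only: hsum_eq elt.scale_left_distrib sum.distrib)
  then show "x + y \<in> range (hsum d)" by blast
next
  fix k x assume "x \<in> range (hsum d)"
  then obtain c where "x = hsum d c" by blast
  then have "psmult k x = hsum d (\<lambda>j. k * c j)"
    by (simp only: hsum_eq elt.scale_sum_right elt.scale_scale)
  then show "psmult k x \<in> range (hsum d)" by blast
qed

lemma triangular:
  assumes "x \<in> L"
  obtains e f c z where "x = e + f + hsum d c + z" "e \<in> nilrad True {}" "f \<in> nilrad False {}" "z \<in> I"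
proof -
  have "x \<in> {x + y |x y. x \<in> {x + y |x y. x \<in> {x + y |x y. x \<in> nilrad True {} \<and> y \<in> nilrad False {}}
      \<and> y \<in> range (hsum d)} \<and> y \<in> I}"
    using triangular_span[OF assms]
    by (simp only: elt.span_Un elt.span_eq_iff[THEN iffD2] subspace_nilrad subspace_hsum subspace_I)
  then show thesis using that by blast
qed

subsection \<open>Removing the imaginary letters\<close>

text \<open>On one side of the triangular decomposition the degree counts the occurrences of the
  letter \<open>i\<close>. It is never negative, and in degree 0 that letter is absent.\<close>

lemma nilrad_degree:
  assumes "e \<in> nilrad s A"
  shows "m < 0 \<Longrightarrow> letter_grading.proj (dgr i s) m e = 0"
    and "letter_grading.proj (dgr i s) 0 e \<in> nilrad s (insert i A)"
proof -
  interpret letter_grading "dgr i s" .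
  let ?T = "{y. (\<forall>m<0. proj m y = 0) \<and> proj 0 y \<in> nilrad s (insert i A)}"
  note N0 = elt.subspace_0[OF subspace_nilrad]
  have "e \<in> ?T"
  proof (rule lie_gen_induct_ad[OF assms[unfolded nilrad_def]])
    show "{gel (sgen s j) |j. j < l \<and> j \<notin> A} \<subseteq> ?T"
      using nilrad_gel N0 by (auto simp: proj_homog[OF homog_gel] dgr_sgen)
    show "elt.subspace ?T"
      using N0 elt.subspace_add[OF subspace_nilrad] elt.subspace_scale[OF subspace_nilrad]
      by (auto simp: elt.subspace_def proj_add proj_smult proj_0)
    fix g z assume "g \<in> {gel (sgen s j) |j. j < l \<and> j \<notin> A}" and z: "z \<in> ?T"
    then obtain j where j: "g = gel (sgen s j)" "j < l" "j \<notin> A" by blast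
    have p: "proj m (br g z) = br g (proj (m - dgr i s (sgen s j)) z)" for m
      using proj_br[OF homog_gel, of "m - dgr i s (sgen s j)" "sgen s j" z] by (simp add: j)
    show "br g z \<in> ?T"
    proof (cases "i = j")
      case True
      then have D: "dgr i s (sgen s j) = 1" by (simp add: dgr_sgen)
      show ?thesis using z N0 by (simp add: p D)
    next
      case False
      then have D: "dgr i s (sgen s j) = 0" by (simp add: dgr_sgen)
      have "g \<in> nilrad s (insert i A)" using False j nilrad_gel by auto
      then show ?thesis using z nilrad_br by (simp add: p D)
    qed
  qed
  then show "m < 0 \<Longrightarrow> proj m e = 0" "proj 0 e \<in> nilrad s (insert i A)" by auto
qed

lemma remove_imaginary:
  assumes "finite A" and e: "e \<in> nilrad s {}"
    and pos: "\<And>i m. i \<in> A \<Longrightarrow> m > 0 \<Longrightarrow> letter_grading.proj (dgr i s) m e \<in> I"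
  shows "\<exists>e'\<in>nilrad s A. e - e' \<in> I"
  using assms(1,3)
proof (induction A)
  case empty
  show "\<exists>e'\<in>nilrad s {}. e - e' \<in> I" using e I_closed(1) by (intro bexI[of _ e]) auto
next
  case (insert i A)
  interpret p: graded_presentation "dgr i s" gens R by (rule graded_presentation_dgr[OF gkm_axioms])
  have "\<exists>e'\<in>nilrad s A. e - e' \<in> I"
    by (rule insert.IH) (use insert.prems in auto)
  then obtain e' where e': "e' \<in> nilrad s A" "e - e' \<in> I" by blast
  then have e'L: "e' \<in> L" using nilrad_L by blast
  define B where "B = insert 0 {m. p.proj m e' \<noteq> 0}"
  have B: "finite B" "{m. p.proj m e' \<noteq> 0} \<subseteq> B"
    using p.finite_degrees[OF e'L] by (auto simp: B_def)
  have "p.proj m e' \<in> I" if "m \<noteq> 0" for m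
  proof (cases "m < 0")
    case True
    then show ?thesis using nilrad_degree(1)[OF e'(1)] I_closed(1) by simp
  next
    case False
    then have "p.proj m e \<in> I" using insert.prems[of i m] that by simp
    moreover have "p.proj m e - p.proj m e' \<in> I" using p.proj_I[OF e'(2)] by (simp only: p.proj_diff)
    ultimately have "p.proj m e - (p.proj m e - p.proj m e') \<in> I" by (rule I_closed(3))
    then show ?thesis by simp
  qed
  then have "(\<Sum>m\<in>B - {0}. p.proj m e') \<in> I" by (intro sum_mem_I) auto
  moreover have "e' = p.proj 0 e' + (\<Sum>m\<in>B - {0}. p.proj m e')"
    using p.sum_proj[OF B] sum.remove[OF B(1), of 0 "\<lambda>m. p.proj m e'"] by (simp only:) (simp add: B_def)
  ultimately have "e' - p.proj 0 e' \<in> I" by (metis add_diff_cancel_left')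
  then have "(e - e') + (e' - p.proj 0 e') \<in> I" using e'(2) by (intro I_closed(2))
  then have "e - p.proj 0 e' \<in> I" by simp
  then show "\<exists>e'\<in>nilrad s (insert i A). e - e' \<in> I" using nilrad_degree(2)[OF e'(1)] by blast
qed

lemma dgr_not: "dgr i (\<not> s) g = - dgr i s g"
  by (auto simp: dgr_def)

lemma proj_dgr_not: "letter_grading.proj (dgr i (\<not> s)) m x = letter_grading.proj (dgr i s) (- m) x"
proof -
  have "letter_grading.deg (dgr i (\<not> s)) w = - letter_grading.deg (dgr i s) w" for w
    by (induction w) (auto simp: letter_grading.deg_def dgr_not)
  then show ?thesis by (auto simp: letter_grading.proj_def fun_eq_iff)
qed

lemma nilrad_real: "nilrad s {i. i < l \<and> a i i \<noteq> 2} \<subseteq> g_B l a d rt cor"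
proof
  fix x assume "x \<in> nilrad s {i. i < l \<and> a i i \<noteq> 2}"
  then show "x \<in> g_B l a d rt cor"
    unfolding nilrad_def g_B_def
    by (rule lie_gen_least) (auto intro: lie_gen.base lie_gen.brk subspace_lie_gen simp: sgen_def)
qed

text \<open>\<open>f\<close> lives in degrees at most 0 and \<open>hsum d c\<close> in degree 0, so
  in positive degree \<open>x\<close> and \<open>e\<close> have the same component modulo
  \<open>I\<close>.\<close>

lemma positive_degree_component:
  assumes x: "x = e + f + hsum d c + z" "e \<in> nilrad s {}" "f \<in> nilrad (\<not> s) {}" "z \<in> I"
    and pos: "letter_grading.proj (dgr i s) m x \<in> I" and m: "m > 0"
  shows "letter_grading.proj (dgr i s) m e \<in> I"
proof -
  interpret p: graded_presentation "dgr i s" gens R by (rule graded_presentation_dgr[OF gkm_axioms])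
  have f: "p.proj m f = 0"
    using nilrad_degree(1)[OF x(3), of "- m" i] m by (simp add: proj_dgr_not)
  have "elt.subspace {y. p.proj m y = 0}"
    by (auto simp: elt.subspace_def p.proj_add p.proj_smult p.proj_0)
  then have "hsum d c \<in> {y. p.proj m y = 0}"
    by (rule hsum_mem) (use m in \<open>simp add: p.proj_homog[OF p.homog_gel]\<close>)
  then have "p.proj m e = p.proj m x - p.proj m z"
    by (simp add: x(1) p.proj_add f)
  then show ?thesis using I_closed(3)[OF pos p.proj_I[OF x(4)]] by simp
qed

section \<open>The subalgebra g'(B) + \<hh>\<close>

lemma subspace_g_B: "elt.subspace (g_B l a d rt cor)"
  by (simp add: g_B_def subspace_lie_gen)

lemma I_g_B: "I \<subseteq> g_B l a d rt cor"
  unfolding g_B_def gkm_ideal_eq by (auto intro: lie_gen.base)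

lemma target_eq: "set_plus_elt (g_B l a d rt cor) (h_part l a d rt cor)
  = elt.span (g_B l a d rt cor \<union> range (hsum d))"
proof -
  have "elt.span (g_B l a d rt cor \<union> range (hsum d))
      = {x + y |x y. x \<in> g_B l a d rt cor \<and> y \<in> range (hsum d)}"
    by (simp only: elt.span_Un elt.span_eq_iff[THEN iffD2] subspace_g_B subspace_hsum)
  also have "\<dots> = set_plus_elt (g_B l a d rt cor) (h_part l a d rt cor)"
    unfolding set_plus_elt_def h_part_def gkm_ideal_eq padd_eq
  proof (intro equalityI subsetI)
    fix v assume "v \<in> {x + y |x y. x \<in> g_B l a d rt cor \<and> y \<in> range (hsum d)}"
    then obtain x c where "v = x + (hsum d c + 0)" "x \<in> g_B l a d rt cor" by auto
    then show "v \<in> {u + v |u v. u \<in> g_B l a d rt cor \<and> v \<in> {hsum d c + z |c z. z \<in> I}}"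
      using I_closed(1) by blast
  next
    fix v assume "v \<in> {u + v |u v. u \<in> g_B l a d rt cor \<and> v \<in> {hsum d c + z |c z. z \<in> I}}"
    then obtain x c z where "v = (x + z) + hsum d c" "x \<in> g_B l a d rt cor" "z \<in> I"
      by (auto simp: algebra_simps)
    then show "v \<in> {x + y |x y. x \<in> g_B l a d rt cor \<and> y \<in> range (hsum d)}"
      using elt.subspace_add[OF subspace_g_B] I_g_B by blast
  qed
  finally show ?thesis ..
qed

lemma g_nil_o_subset: "g_nil_o l a d rt cor \<subseteq> elt.span (g_B l a d rt cor \<union> range (hsum d))"
proof
  fix x assume x: "x \<in> g_nil_o l a d rt cor"
  then have "x \<in> L" by (simp add: g_nil_o_def free_L_eq)
  then obtain e f c z where xeq: "x = e + f + hsum d c + z" "e \<in> nilrad True {}" "f \<in> nilrad False {}" "z \<in> I"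
    using triangular by blast
  let ?A = "{i. i < l \<and> a i i \<noteq> 2}"
  have "letter_grading.proj (dgr i True) m e \<in> I" if "i \<in> ?A" "m > 0" for i m
    using positive_degree_component[OF xeq(1,2) _ xeq(4) _ that(2)] xeq(3) nil_positive_degree[OF x] that by simp
  then obtain e' where e': "e' \<in> nilrad True ?A" "e - e' \<in> I"
    using remove_imaginary[OF _ xeq(2), of ?A] by auto
  \<comment> \<open>With the first two summands exchanged, the argument for \<open>e\<close> applies
    to \<open>f\<close> with the flag reversed.\<close>
  have "x = f + e + hsum d c + z" using xeq(1) by (simp add: add.commute)
  then have "letter_grading.proj (dgr i False) m f \<in> I" if "i \<in> ?A" "m > 0" for i m
    using positive_degree_component[OF _ xeq(3) _ xeq(4) _ that(2), of x e c] xeq(2) nil_positive_degree[OF x] that by simp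
  then obtain f' where f': "f' \<in> nilrad False ?A" "f - f' \<in> I"
    using remove_imaginary[OF _ xeq(3), of ?A] by auto
  have "e' + f' + (e - e') + (f - f') + z \<in> g_B l a d rt cor"
    using e' f' xeq(4) nilrad_real I_g_B by (intro elt.subspace_add[OF subspace_g_B]) auto
  then have "e' + f' + (e - e') + (f - f') + z + hsum d c \<in> elt.span (g_B l a d rt cor \<union> range (hsum d))"
    by (intro elt.span_add elt.span_base) auto
  also have "e' + f' + (e - e') + (f - f') + z + hsum d c = x" by (simp add: xeq(1))
  finally show "x \<in> elt.span (g_B l a d rt cor \<union> range (hsum d))" .
qed

text \<open>Generators of g'(B) are weight vectors modulo \<open>I\<close>, and \<open>I\<close> is
  part of the preimage; so \<hh> normalizes g'(B).\<close>

lemma hsum_g_B: "y \<in> g_B l a d rt cor \<Longrightarrow> br (hsum d c) y \<in> g_B l a d rt cor"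
  unfolding g_B_def gkm_ideal_eq
proof (erule lie_gen_derivation[rotated])
  let ?S = "{gel (E i) |i. i < l \<and> a i i = 2} \<union> {gel (F i) |i. i < l \<and> a i i = 2} \<union> I"
  fix u assume "u \<in> ?S"
  then consider s i where "i < l" "u = gel (sgen s i)" "u \<in> ?S" | "u \<in> I"
    unfolding sgen_def by (auto split: if_splits) metis+
  then show "br (hsum d c) u \<in> lie_gen ?S"
  proof cases
    case 1
    have "br (hsum d c) u - psmult (sg s * coweight i c) u \<in> lie_gen ?S"
      using hsum_sgen[OF 1(1)] 1(2) by (auto intro: lie_gen.base)
    moreover have "psmult (sg s * coweight i c) u \<in> lie_gen ?S" using 1(3) by (intro lie_gen.smult lie_gen.base)
    ultimately have "br (hsum d c) u - psmult (sg s * coweight i c) u + psmult (sg s * coweight i c) u \<in> lie_gen ?S"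
      by (rule elt.subspace_add[OF subspace_lie_gen])
    then show ?thesis by simp
  next
    case 2
    then show ?thesis using bracket_I[OF hsum_L] by (auto intro: lie_gen.base)
  qed
qed

lemma g_nil_subset: "g_nil l a d rt cor \<subseteq> set_plus_elt (g_B l a d rt cor) (h_part l a d rt cor)"
  unfolding target_eq
proof
  let ?B = "g_B l a d rt cor"
  let ?Q = "elt.span (?B \<union> range (hsum d))"
  fix x assume x: "x \<in> g_nil l a d rt cor"
  show "x \<in> ?Q"
  proof (rule lie_gen_least[OF x[unfolded g_nil_def gkm_ideal_eq]])
    show "g_nil_o l a d rt cor \<union> I \<subseteq> ?Q"
      using g_nil_o_subset I_g_B by (auto intro: elt.span_base)
    show "elt.subspace ?Q" by (rule elt.subspace_span)
    fix u v assume u: "u \<in> ?Q" and v: "v \<in> ?Q"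
    show "br u v \<in> ?Q"
    proof (rule br_span_left[OF elt.subspace_span _ u], rule br_span[OF elt.subspace_span _ v])
      fix y z assume y: "y \<in> ?B \<union> range (hsum d)" and z: "z \<in> ?B \<union> range (hsum d)"
      have anti: "br y z = - br z y" by (rule elt.bracket_anti)
      \<comment> \<open>Every bracket of two spanning elements falls into g'(B): \<hh> normalizes
        it, and brackets within \<hh> lie in \<open>I\<close>.\<close>
      have "br y z \<in> ?B"
      proof (cases "y \<in> ?B")
        case yB: True
        show ?thesis
        proof (cases "z \<in> ?B")
          case True
          with yB show ?thesis unfolding g_B_def by (rule lie_gen.brk)
        next
          case False
          then show ?thesis using z yB hsum_g_B elt.subspace_neg[OF subspace_g_B] by (auto simp: anti)
        qed
      next
        case False
        then obtain c where c: "y = hsum d c" using y by blast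
        show ?thesis
        proof (cases "z \<in> ?B")
          case True
          then show ?thesis using hsum_g_B c by simp
        next
          case False
          then show ?thesis using z c hsum_hsum I_g_B by auto
        qed
      qed
      then show "br y z \<in> ?Q" by (blast intro: elt.span_base)
    qed
  qed
qed

end

theorem theorem1:
  fixes l d :: nat and a :: rmat and rt cor :: "nat \<Rightarrow> nat \<Rightarrow> complex"
  assumes "gkm_matrix l a"
    and "symmetrizable l a"
    and "indecomposable l a"
    and "l \<ge> 2"
    and "realization l a d rt cor"
  shows "g_B l a d rt cor \<subseteq> g_nil l a d rt cor \<and>
         g_nil l a d rt cor \<subseteq> set_plus_elt (g_B l a d rt cor) (h_part l a d rt cor)"
proof -
  interpret gkm l d a rt cor by unfold_locales (rule assms)+
  show ?thesis using g_B_subset g_nil_subset by blast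
qed

end
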